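(* Let $\mathbf{X}\subseteq\Sigma^{\mathbb{Z}^2}$ be a countable subshift of finite type. Then there exists no infinite decreasing chain down to level $1$ for $\preceq$ in $\mathbf{X}$.
   Context: $\Sigma$ is a finite alphabet; a configuration is an element of $\Sigma^{\mathbb{Z}^2}$. A pattern is an element $P\in\Sigma^V$ with $V\subset\mathbb{Z}^2$ finite; $P$ appears in a configuration $c$ if there is $v\in\mathbb{Z}^2$ with $c(a+v)=P(a)$ for all $a\in V$. A subshift is the set of all configurations in which no pattern of a given set $\mathcal{F}$ of patterns appears; it is of finite type (an SFT) if it can be so defined with $\mathcal{F}$ finite. Write $x\preceq y$ if every pattern appearing in $x$ appears in $y$; $x\approx y$ if $x\preceq y$ and $y\preceq x$; $x\prec y$ if $x\preceq y$ and not $x\approx y$. The level of $c\in\mathbf{X}$ is the length of the longest strictly decreasing chain for $\preceq$ in $\mathbf{X}$ starting at $c$, where a chain $c=c_0\succ c_1\succ\dots\succ c_n$ has length $n$ (so level $0$ means minimal for $\preceq$); if such chains can be arbitrarily long, $c$ has infinite level. An infinite decreasing chain down to level $k$ is an infinite sequence $(c_n)_{n\in\mathbb{N}}$ of configurations of $\mathbf{X}$ with $c_{n+1}\prec c_n$ for all $n$, such that every configuration $x$ with $x\preceq c_n$ for all $n$ has level at most $k$. *)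

theory Defs
  imports "HOL-Library.Product_Plus" "HOL-Library.Countable_Set" "HOL-Library.Extended_Nat"
begin

type_synonym 'a config = "int \<times> int \<Rightarrow> 'a"

text \<open>An element of \<open>\<Sigma>\<^sup>V\<close> is a partial map with domain \<open>V\<close>; it is a pattern if \<open>V\<close> is finite.\<close>
type_synonym 'a pat = "int \<times> int \<rightharpoonup> 'a"

definition is_pattern :: "'a pat \<Rightarrow> bool" where
  "is_pattern P \<longleftrightarrow> finite (dom P)"

definition appears :: "'a pat \<Rightarrow> 'a config \<Rightarrow> bool" where
  "appears P c \<longleftrightarrow> (\<exists>v. \<forall>a\<in>dom P. P a = Some (c (a + v)))"

definition subshift_of :: "'a pat set \<Rightarrow> 'a config set" where
  "subshift_of F = {c. \<forall>P\<in>F. \<not> appears P c}"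

definition is_SFT :: "'a config set \<Rightarrow> bool" where
  "is_SFT X \<longleftrightarrow> (\<exists>F. finite F \<and> (\<forall>P\<in>F. is_pattern P) \<and> X = subshift_of F)"

definition pat_le :: "'a config \<Rightarrow> 'a config \<Rightarrow> bool"  (infix "\<preceq>" 50) where
  "x \<preceq> y \<longleftrightarrow> (\<forall>P. is_pattern P \<longrightarrow> appears P x \<longrightarrow> appears P y)"

definition pat_equiv :: "'a config \<Rightarrow> 'a config \<Rightarrow> bool"  (infix "\<approx>" 50) where
  "x \<approx> y \<longleftrightarrow> x \<preceq> y \<and> y \<preceq> x"

definition pat_less :: "'a config \<Rightarrow> 'a config \<Rightarrow> bool"  (infix "\<prec>" 50) where
  "x \<prec> y \<longleftrightarrow> x \<preceq> y \<and> \<not> x \<approx> y"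

definition decreasing_chain :: "'a config set \<Rightarrow> nat \<Rightarrow> (nat \<Rightarrow> 'a config) \<Rightarrow> bool" where
  "decreasing_chain X n c \<longleftrightarrow> (\<forall>i\<le>n. c i \<in> X) \<and> (\<forall>i<n. c (Suc i) \<prec> c i)"

text \<open>The supremum is \<open>\<infinity>\<close> exactly when there are arbitrarily long chains from \<open>x\<close>; otherwise, for
  \<open>x \<in> X\<close>, it is a maximum. The value is meaningful only for \<open>x \<in> X\<close>.\<close>
definition level :: "'a config set \<Rightarrow> 'a config \<Rightarrow> enat" where
  "level X x = Sup {enat n | n. \<exists>c. c 0 = x \<and> decreasing_chain X n c}"

text \<open>If \<open>X\<close> is a subshift, every \<open>x\<close> below all \<open>c n\<close> lies in \<open>X\<close>, so that \<open>level X x\<close> is meaningful.\<close>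
definition infinite_decreasing_chain_down_to ::
    "'a config set \<Rightarrow> nat \<Rightarrow> (nat \<Rightarrow> 'a config) \<Rightarrow> bool" where
  "infinite_decreasing_chain_down_to X k c \<longleftrightarrow>
     (\<forall>n. c n \<in> X) \<and> (\<forall>n. c (Suc n) \<prec> c n) \<and>
     (\<forall>x. (\<forall>n. x \<preceq> c n) \<longrightarrow> level X x \<le> enat k)"

end

theory Submission
  imports Defs "HOL-Library.FuncSet" "HOL-Library.Infinite_Set"
begin

text \<open>
  Let \<open>c 0 \<succ> c 1 \<succ> \<dots>\<close> be a chain in the countable SFT \<open>X\<close> and let \<open>Y\<close> be the subshift of all
  configurations below every \<open>c n\<close>. If all elements of \<open>Y\<close> have level at most one, then three facts
  together make the chain impossible.

  First, an element of level at most one has a nonzero period (\<open>level_le_1_has_period\<close>). The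
  configurations below it are, apart from one isolated orbit, minimal; and a minimal configuration
  of a countable subshift is doubly periodic. If the configuration on the isolated orbit had no
  period, it would be a finite defect in a doubly periodic background. In an SFT such a defect can
  be inserted or left out independently at infinitely many places, which yields uncountably many
  configurations (\<open>finite_defect_uncountable\<close>).

  Second, if every element of the countable subshift \<open>Y\<close> has a nonzero period, then finitely many
  periods suffice for all of \<open>Y\<close>, and this remains so for every set of configurations whose
  patterns of a certain size all occur in \<open>Y\<close>. The reason for the latter is
  \<open>locally_periodic_imp_periodic\<close>: where two nonparallel directions of local periodicity meet, the
  configuration looks doubly periodic, so a violation of a period has only one direction and
  propagates along a line of that direction; but violations in two nonparallel directions would
  propagate along lines that meet. By compactness the patterns of \<open>c n\<close> of a given size all occur
  in \<open>Y\<close> once \<open>n\<close> is large, so some \<open>c n\<close> has a nonzero period.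

  Third, a configuration with a nonzero period is a walk in a finite graph, and a walk in a graph
  with only countably many walks is eventually periodic in both directions
  (\<open>walk_eventually_periodic\<close>). Hence a configuration below \<open>c n\<close> is a translate of \<open>c n\<close> or
  doubly periodic (\<open>below_periodic_config\<close>). So \<open>c (n + 1)\<close> is doubly periodic, thus minimal, and
  cannot lie strictly above \<open>c (n + 2)\<close>.
\<close>

section \<open>Configurations, translations and compactness\<close>

text \<open>Points of the plane are treated as single vectors; quantifiers over them should not be split
  into quantifiers over coordinates.\<close>
declare split_paired_All [simp del] split_paired_Ex [simp del]

definition translate :: "int \<times> int \<Rightarrow> 'a config \<Rightarrow> 'a config" where
  "translate v c = (\<lambda>a. c (a + v))"

definition orbit :: "'a config \<Rightarrow> 'a config set" where
  "orbit c = range (\<lambda>v. translate v c)"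

definition square :: "nat \<Rightarrow> (int \<times> int) set" where
  "square R = {v. \<bar>fst v\<bar> \<le> int R \<and> \<bar>snd v\<bar> \<le> int R}"

definition agree :: "nat \<Rightarrow> 'a config \<Rightarrow> 'a config \<Rightarrow> bool" where
  "agree R x y \<longleftrightarrow> (\<forall>a\<in>square R. x a = y a)"

lemma translate_translate [simp]: "translate u (translate v c) = translate (u + v) c"
  by (simp add: translate_def add.assoc)

lemma translate_0 [simp]: "translate 0 c = c"
  by (simp add: translate_def)

lemma translate_eq_iff: "translate v x = y \<longleftrightarrow> x = translate (- v) y"
  by (metis add.left_inverse add.right_inverse translate_0 translate_translate)

lemma self_in_orbit: "c \<in> orbit c"
  unfolding orbit_def by (metis rangeI translate_0)

lemma orbit_translate [simp]: "translate v x \<in> orbit c \<longleftrightarrow> x \<in> orbit c"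
proof -
  have "translate u y \<in> orbit c" if "y \<in> orbit c" for u y
    using that unfolding orbit_def by auto
  from this[of x v] this[of "translate v x" "- v"] show ?thesis
    by (metis add.left_inverse translate_0 translate_translate)
qed

lemma square_mono: "R \<le> S \<Longrightarrow> square R \<subseteq> square S"
  unfolding square_def by auto

lemma zero_in_square [simp]: "0 \<in> square R"
  unfolding square_def by simp

lemma uminus_in_square [simp]: "- v \<in> square R \<longleftrightarrow> v \<in> square R"
  unfolding square_def by simp

lemma add_in_square: "u \<in> square R \<Longrightarrow> v \<in> square S \<Longrightarrow> u + v \<in> square (R + S)"
  unfolding square_def by auto

lemma finite_square: "finite (square R)"
proof (rule finite_subset)
  show "square R \<subseteq> {- int R..int R} \<times> {- int R..int R}"
    unfolding square_def by auto
qed auto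

lemma ex_square: "\<exists>R. v \<in> square R"
  unfolding square_def by (rule exI[of _ "nat (max \<bar>fst v\<bar> \<bar>snd v\<bar>)"]) auto

lemma eventually_in_square: "eventually (\<lambda>R. v \<in> square R) sequentially"
  using ex_square[of v] square_mono unfolding eventually_sequentially by blast

lemma finite_subset_square: "finite S \<Longrightarrow> \<exists>R. S \<subseteq> square R"
  using eventually_ball_finite[of S "\<lambda>R v. v \<in> square R" sequentially] eventually_in_square
  unfolding eventually_sequentially by blast

lemma agree_mono: "R \<le> S \<Longrightarrow> agree S x y \<Longrightarrow> agree R x y"
  unfolding agree_def using square_mono by blast

lemma agree_sym: "agree R x y \<Longrightarrow> agree R y x"
  unfolding agree_def by auto

lemma agree_trans: "agree R x y \<Longrightarrow> agree R y z \<Longrightarrow> agree R x z"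
  unfolding agree_def by auto

lemma agree_refl [simp]: "agree R x x"
  unfolding agree_def by auto

lemma agreeD: "agree R x y \<Longrightarrow> a \<in> square R \<Longrightarrow> x a = y a"
  unfolding agree_def by auto

lemma agree_translate:
  "agree (R + S) x y \<Longrightarrow> v \<in> square S \<Longrightarrow> agree R (translate v x) (translate v y)"
  unfolding agree_def translate_def by (auto intro: add_in_square)

lemma agree_all_eq: "(\<And>R. agree R x y) \<Longrightarrow> x = y"
  unfolding agree_def using ex_square by (metis ext)

text \<open>Refine an infinite set of indices position by position so that the values there become
  constant; the values chosen in this way form the limit. A cluster point spares the reindexing
  that a convergent subsequence would bring.\<close>
lemma cluster_point:
  fixes f :: "nat \<Rightarrow> ('a::finite) config"
  shows "\<exists>l. \<forall>R m. \<exists>n\<ge>m. agree R (f n) l"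
proof -
  define pos :: "nat \<Rightarrow> int \<times> int" where "pos = from_nat_into UNIV"
  have surj: "\<exists>k. pos k = v" for v
    unfolding pos_def by (metis UNIV_I countableI_type from_nat_into_surj)
  have step: "\<exists>B. (infinite B \<and> (\<forall>n\<in>B. \<forall>m\<in>B. f n (pos k) = f m (pos k))) \<and> B \<subseteq> A"
    if A: "infinite A" for A :: "nat set" and k
  proof -
    have "\<exists>a\<in>A. infinite {b\<in>A. f b (pos k) = f a (pos k)}"
      by (rule pigeonhole_infinite[OF A]) (rule finite_subset[OF subset_UNIV], simp)
    then obtain a where "a \<in> A" "infinite {b\<in>A. f b (pos k) = f a (pos k)}" by blast
    then show ?thesis
      by (intro exI[of _ "{b\<in>A. f b (pos k) = f a (pos k)}"]) auto
  qed
  define P where "P k B \<longleftrightarrow> infinite B \<and>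
    (k > 0 \<longrightarrow> (\<forall>n\<in>B. \<forall>m\<in>B. f n (pos (k - 1)) = f m (pos (k - 1))))" for k :: nat and B :: "nat set"
  have "\<exists>A. \<forall>k. P k (A k) \<and> A (Suc k) \<subseteq> A k"
  proof (rule dependent_nat_choice)
    show "\<exists>x. P 0 x" unfolding P_def by (intro exI[of _ UNIV]) simp
    show "\<exists>y. P (Suc k) y \<and> y \<subseteq> x" if "P k x" for x k
      using step[of x k] that unfolding P_def by auto
  qed
  then obtain A where A: "\<And>k. P k (A k)" "\<And>k. A (Suc k) \<subseteq> A k" by blast
  have Asub: "A k \<subseteq> A j" if "j \<le> k" for j k
    using A(2) that by (rule lift_Suc_antimono_le)
  have Ane: "A k \<noteq> {}" for k using A(1)[of k] unfolding P_def by auto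
  define idx where "idx v = (SOME k. pos k = v)" for v
  have idx: "pos (idx v) = v" for v unfolding idx_def using surj by (rule someI_ex)
  define l where "l v = f (SOME n. n \<in> A (Suc (idx v))) v" for v
  have l: "f n v = l v" if "n \<in> A (Suc (idx v))" for n v
  proof -
    have "(SOME n. n \<in> A (Suc (idx v))) \<in> A (Suc (idx v))" using that by (rule someI)
    moreover have "\<forall>n\<in>A (Suc (idx v)). \<forall>m\<in>A (Suc (idx v)). f n v = f m v"
      using A(1)[of "Suc (idx v)"] unfolding P_def diff_Suc_1 idx by blast
    ultimately show ?thesis using that unfolding l_def by blast
  qed
  show ?thesis
  proof (intro exI[of _ l] allI)
    fix R m
    obtain K where K: "\<forall>v\<in>square R. Suc (idx v) \<le> K"
      using finite_nat_set_iff_bounded_le[of "(\<lambda>v. Suc (idx v)) ` square R"] finite_square by blast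
    have "infinite (A K)" using A(1)[of K] unfolding P_def by simp
    then obtain n where n: "n \<in> A K" "n \<ge> m"
      by (metis infinite_nat_iff_unbounded_le)
    then have "agree R (f n) l"
      unfolding agree_def using K Asub l by blast
    with n show "\<exists>n\<ge>m. agree R (f n) l" by blast
  qed
qed

section \<open>Countable subshifts\<close>

text \<open>The topological form, translation invariant and closed, of the sets defined by
  forbidden patterns.\<close>
definition subshift :: "'a config set \<Rightarrow> bool" where
  "subshift Z \<longleftrightarrow> (\<forall>z\<in>Z. \<forall>v. translate v z \<in> Z) \<and>
     (\<forall>y. (\<forall>R. \<exists>z\<in>Z. agree R z y) \<longrightarrow> y \<in> Z)"

lemma subshift_translate: "subshift Z \<Longrightarrow> z \<in> Z \<Longrightarrow> translate v z \<in> Z"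
  unfolding subshift_def by blast

lemma subshift_limit: "subshift Z \<Longrightarrow> (\<And>R. \<exists>z\<in>Z. agree R z y) \<Longrightarrow> y \<in> Z"
  unfolding subshift_def by blast

lemma subshift_Inter:
  assumes "\<And>n. subshift (Z n)"
  shows "subshift (\<Inter>n. Z n)"
  unfolding subshift_def
proof (intro conjI ballI allI impI INT_I)
  show "translate v z \<in> Z n" if "z \<in> (\<Inter>n. Z n)" for z v n
    using that subshift_translate[OF assms] by blast
  show "y \<in> Z n" if "\<forall>R. \<exists>z\<in>\<Inter>n. Z n. agree R z y" for y n
    using assms by (rule subshift_limit) (use that in blast)
qed

definition isolated_in :: "'a config set \<Rightarrow> nat \<Rightarrow> 'a config \<Rightarrow> bool" where
  "isolated_in A R a \<longleftrightarrow> a \<in> A \<and> (\<forall>b\<in>A. agree R b a \<longrightarrow> b = a)"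

text \<open>If no element were isolated, patterns could be extended step by step inside
  \<open>A\<close> so that the \<open>n\<close>-th one excludes the \<open>n\<close>-th element of
  an enumeration of \<open>A\<close>. The limit would be an element of \<open>A\<close> that the
  enumeration misses.\<close>
lemma countable_subshift_isolated:
  fixes A :: "('a::finite) config set"
  assumes A: "subshift A" "countable A" "A \<noteq> {}"
  obtains a R where "isolated_in A R a"
proof (rule ccontr)
  assume "\<not> thesis"
  with that have perfect: "\<exists>b\<in>A. agree R b a \<and> b \<noteq> a" if "a \<in> A" for a R
    using that unfolding isolated_in_def by blast
  define e where "e = from_nat_into A"
  have e: "\<exists>n. e n = a" if "a \<in> A" for a
    using A that unfolding e_def by (metis from_nat_into_surj)
  define P where "P n p \<longleftrightarrow> fst p \<in> A \<and> n \<le> snd p" for n :: nat and p :: "'a config \<times> nat"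
  define Q where "Q n p p' \<longleftrightarrow> agree (snd p) (fst p') (fst p) \<and> snd p \<le> snd p' \<and>
    \<not> agree (snd p') (fst p') (e n)" for n :: nat and p p' :: "'a config \<times> nat"
  have "\<exists>F. \<forall>n. P n (F n) \<and> Q n (F n) (F (Suc n))"
  proof (rule dependent_nat_choice)
    show "\<exists>p. P 0 p" using A(3) unfolding P_def by (metis ex_in_conv fst_conv le0)
    fix p n assume "P n p"
    then have p: "fst p \<in> A" "n \<le> snd p" unfolding P_def by auto
    obtain b where b: "b \<in> A" "agree (snd p) b (fst p)" "b \<noteq> e n"
      using perfect[OF p(1), of "snd p"] p(1) by (metis agree_refl)
    obtain S where S: "\<not> agree S b (e n)" using b(3) agree_all_eq by blast
    define S' where "S' = S + Suc (snd p)"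
    have "\<not> agree S' b (e n)" using S agree_mono[of S S'] unfolding S'_def by fastforce
    then show "\<exists>q. P (Suc n) q \<and> Q n p q"
      unfolding P_def Q_def using b p by (intro exI[of _ "(b, S')"]) (auto simp: S'_def)
  qed
  then obtain F where F: "\<And>n. P n (F n)" "\<And>n. Q n (F n) (F (Suc n))" by blast
  have mono: "snd (F m) \<le> snd (F n)" if "m \<le> n" for m n
    using that F(2) unfolding Q_def by (induction rule: dec_induct) (auto intro: order_trans)
  have agr: "agree (snd (F m)) (fst (F n)) (fst (F m))" if "m \<le> n" for m n
    using that
  proof (induction rule: dec_induct)
    case (step n)
    have "agree (snd (F n)) (fst (F (Suc n))) (fst (F n))" using F(2)[of n] unfolding Q_def by simp
    then have "agree (snd (F m)) (fst (F (Suc n))) (fst (F n))"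
      using agree_mono mono step.hyps by blast
    then show ?case using step.IH agree_trans by blast
  qed simp
  obtain l where l: "\<And>R m. \<exists>n\<ge>m. agree R (fst (F n)) l" using cluster_point[of "\<lambda>n. fst (F n)"] by blast
  have "l \<in> A" by (rule subshift_limit[OF A(1)]) (use l[of 0] F(1) P_def in metis)
  then obtain n where n: "e n = l" using e by blast
  obtain k where k: "k \<ge> Suc n" "agree (snd (F (Suc n))) (fst (F k)) l" using l by blast
  with agr[OF k(1)] have "agree (snd (F (Suc n))) (fst (F (Suc n))) l"
    using agree_sym agree_trans by blast
  with F(2)[of n] n show False unfolding Q_def by simp
qed

lemma isolated_translateD:
  assumes "isolated_in A R a" "subshift A" "b \<in> A" "v \<in> square S"
    "agree (R + S) b (translate v a)"
  shows "b = translate v a"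
proof -
  have "agree R (translate (- v) b) a"
    using agree_translate[OF assms(5), of "- v"] assms(4) by simp
  moreover have "translate (- v) b \<in> A" using assms subshift_translate by blast
  ultimately have "translate (- v) b = a" using assms(1) unfolding isolated_in_def by blast
  then show ?thesis by (simp add: translate_eq_iff)
qed

text \<open>An isolated orbit is open in \<open>A\<close>: a limit of other elements can be
  translated back to \<open>a\<close>, where isolation forbids it.\<close>
lemma subshift_remove_isolated_orbit:
  assumes "subshift A" "isolated_in A R a"
  shows "subshift (A - orbit a)"
  unfolding subshift_def
proof (intro conjI allI ballI impI)
  show "translate v z \<in> A - orbit a" if "z \<in> A - orbit a" for z v
    using that subshift_translate[OF assms(1)] by (metis Diff_iff orbit_translate)
  fix y assume y: "\<forall>R. \<exists>z\<in>A - orbit a. agree R z y"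
  have "y \<in> A"
    by (rule subshift_limit[OF assms(1)]) (use y in blast)
  moreover have "y \<notin> orbit a"
  proof
    assume "y \<in> orbit a"
    then obtain v where v: "y = translate v a" unfolding orbit_def by blast
    obtain S where S: "v \<in> square S" using ex_square by blast
    obtain z where z: "z \<in> A - orbit a" "agree (R + S) z y" using y by blast
    then have "z = translate v a"
      using isolated_translateD[OF assms(2,1) _ S] v by blast
    with z show False unfolding orbit_def by blast
  qed
  ultimately show "y \<in> A - orbit a" by blast
qed

text \<open>Over a finite alphabet these are the approximations of a subshift \<open>Z\<close>
  from outside by subshifts of finite type: only patterns of radius \<open>T\<close> are compared
  with those of \<open>Z\<close>.\<close>
definition loc :: "nat \<Rightarrow> 'a config set \<Rightarrow> 'a config set" where
  "loc T Z = {y. \<forall>v. \<exists>z\<in>Z. agree T (translate v y) z}"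

text \<open>Otherwise every \<open>Z n\<close> contains, at the origin, a pattern of radius
  \<open>T\<close> foreign to the intersection. A cluster point of such configurations lies in all
  \<open>Z n\<close> and still shows a foreign pattern.\<close>
lemma decreasing_subshifts_loc:
  fixes Z :: "nat \<Rightarrow> ('a::finite) config set"
  assumes "\<And>n. subshift (Z n)" "\<And>n. Z (Suc n) \<subseteq> Z n"
  shows "\<exists>n. Z n \<subseteq> loc T (\<Inter>n. Z n)"
proof (rule ccontr)
  assume neg: "\<not> ?thesis"
  have "\<forall>n. \<exists>y. y \<in> Z n \<and> (\<forall>z\<in>(\<Inter>n. Z n). \<not> agree T y z)"
  proof (intro allI)
    fix n
    obtain z where z: "z \<in> Z n" "z \<notin> loc T (\<Inter>n. Z n)" using neg by blast
    then obtain v where v: "\<forall>x\<in>(\<Inter>n. Z n). \<not> agree T (translate v z) x"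
      unfolding loc_def mem_Collect_eq by meson
    show "\<exists>y. y \<in> Z n \<and> (\<forall>z\<in>(\<Inter>n. Z n). \<not> agree T y z)"
      using subshift_translate[OF assms(1) z(1)] v by meson
  qed
  then obtain y where y: "\<And>n. y n \<in> Z n" "\<And>n z. z \<in> (\<Inter>n. Z n) \<Longrightarrow> \<not> agree T (y n) z"
    by metis
  obtain l where l: "\<And>R m. \<exists>n\<ge>m. agree R (y n) l" using cluster_point[of y] by blast
  have "l \<in> Z m" for m
  proof (rule subshift_limit[OF assms(1)])
    fix R
    obtain n where "n \<ge> m" "agree R (y n) l" using l by blast
    moreover have "Z n \<subseteq> Z m" using assms(2) \<open>n \<ge> m\<close> by (rule lift_Suc_antimono_le)
    ultimately show "\<exists>z\<in>Z m. agree R z l" using y(1) by blast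
  qed
  then have "l \<in> (\<Inter>n. Z n)" by blast
  with l y(2) show False by blast
qed

text \<open>This takes the place of a transfinite induction on the Cantor-Bendixson rank. If
  \<open>Y\<close> fails \<open>G\<close>, pass through an enumeration of \<open>Y\<close> and
  shrink to a failing subshift that omits the current element whenever there is one. By
  compactness and \<open>local\<close> the intersection \<open>A\<close> still fails. It has an
  isolated element \<open>a\<close>; removing the orbit of \<open>a\<close> leaves a subshift that
  has \<open>G\<close>, since otherwise \<open>a\<close> would have been omitted at its turn, and
  adding the orbit back gives \<open>G A\<close>.\<close>
lemma countable_subshift_induct:
  fixes Y :: "('a::finite) config set"
  assumes Y: "subshift Y" "countable Y"
    and empty: "G {}"
    and add: "\<And>A a. G A \<Longrightarrow> a \<in> Y \<Longrightarrow> G (A \<union> orbit a)"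
    and local: "\<And>Z. subshift Z \<Longrightarrow> G Z \<Longrightarrow> \<exists>T. \<forall>A. A \<subseteq> loc T Z \<longrightarrow> G A"
  shows "G Y"
proof (rule ccontr)
  assume bad: "\<not> G Y"
  with empty have "Y \<noteq> {}" by auto
  define e where "e = from_nat_into Y"
  have e: "\<exists>n. e n = a" if "a \<in> Y" for a
    using Y that unfolding e_def by (metis from_nat_into_surj)
  define P where "P n B \<longleftrightarrow> subshift B \<and> B \<subseteq> Y \<and> \<not> G B" for n :: nat and B
  define Q where "Q n B B' \<longleftrightarrow> B' \<subseteq> B \<and>
    (e n \<in> B' \<longrightarrow> (\<forall>C. subshift C \<longrightarrow> C \<subseteq> B \<longrightarrow> e n \<notin> C \<longrightarrow> G C))" for n B B'
  have "\<exists>B. \<forall>n. P n (B n) \<and> Q n (B n) (B (Suc n))"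
  proof (rule dependent_nat_choice)
    show "\<exists>B. P 0 B" using Y bad unfolding P_def by blast
    show "\<exists>B'. P (Suc n) B' \<and> Q n B B'" if "P n B" for B n
      using that unfolding P_def Q_def by (meson order_refl order_trans)
  qed
  then obtain B where B: "\<And>n. P n (B n)" "\<And>n. Q n (B n) (B (Suc n))" by blast
  define A where "A = (\<Inter>n. B n)"
  have sub: "subshift A" unfolding A_def by (rule subshift_Inter) (use B(1) in \<open>simp add: P_def\<close>)
  have AY: "A \<subseteq> Y" unfolding A_def using B(1) by (auto simp: P_def)
  have badA: "\<not> G A"
  proof
    assume "G A"
    then obtain T where T: "\<forall>C. C \<subseteq> loc T A \<longrightarrow> G C" using local[OF sub] by blast
    obtain n where "B n \<subseteq> loc T A"
      unfolding A_def using decreasing_subshifts_loc[of B T] B unfolding P_def Q_def by blast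
    with T B(1)[of n] show False unfolding P_def by blast
  qed
  have "A \<noteq> {}" using badA empty by auto
  then obtain a R where iso: "isolated_in A R a"
    using countable_subshift_isolated[OF sub countable_subset[OF AY Y(2)]] by metis
  then have a: "a \<in> A" unfolding isolated_in_def by blast
  have sub': "subshift (A - orbit a)" using sub iso by (rule subshift_remove_isolated_orbit)
  obtain n where n: "e n = a" using e a AY by blast
  have "a \<in> B (Suc n)" "A \<subseteq> B n" using a unfolding A_def by auto
  then have "G (A - orbit a)"
    using B(2)[of n] sub' n self_in_orbit[of a] unfolding Q_def by blast
  moreover have "A = (A - orbit a) \<union> orbit a"
    using subshift_translate[OF sub a] unfolding orbit_def by auto
  ultimately have "G A" using add a AY by (metis subsetD)
  with badA show False by blast
qed

section \<open>Periods\<close>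

definition smul :: "int \<Rightarrow> int \<times> int \<Rightarrow> int \<times> int" where
  "smul k v = (k * fst v, k * snd v)"

definition cross :: "int \<times> int \<Rightarrow> int \<times> int \<Rightarrow> int" where
  "cross u v = fst u * snd v - snd u * fst v"

definition has_period :: "'a config \<Rightarrow> int \<times> int \<Rightarrow> bool" where
  "has_period c u \<longleftrightarrow> (\<forall>a. c (a + u) = c a)"

lemma smul_simps [simp]: "smul 0 v = 0" "smul 1 v = v" "smul (- k) v = - smul k v"
  by (simp_all add: smul_def prod_eq_iff)

lemma smul_add: "smul (j + k) v = smul j v + smul k v"
  by (simp add: smul_def prod_eq_iff algebra_simps)

lemma smul_smul: "smul j (smul k v) = smul (j * k) v"
  by (simp add: smul_def prod_eq_iff algebra_simps)

lemma smul_eq_0_iff: "smul k v = 0 \<longleftrightarrow> k = 0 \<or> v = 0"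
  by (auto simp add: smul_def prod_eq_iff)

lemma cross_smul: "cross (smul j u) v = j * cross u v" "cross u (smul j v) = j * cross u v"
  by (simp_all add: smul_def cross_def algebra_simps)

lemma cross_swap: "cross u v = - cross v u"
  by (simp add: cross_def)

lemma has_period_iff: "has_period c u \<longleftrightarrow> translate u c = c"
  unfolding has_period_def translate_def by (auto simp: fun_eq_iff)

lemma has_period_translate [simp]: "has_period (translate v c) u \<longleftrightarrow> has_period c u"
  unfolding has_period_iff
  by (metis add.commute translate_translate translate_eq_iff)

lemma has_period_add: "has_period c u \<Longrightarrow> has_period c v \<Longrightarrow> has_period c (u + v)"
  unfolding has_period_iff by (metis translate_translate)

lemma has_period_uminus: "has_period c u \<Longrightarrow> has_period c (- u)"
  unfolding has_period_iff by (metis translate_eq_iff)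

lemma has_period_smul:
  assumes "has_period c u"
  shows "has_period c (smul k u)"
proof (induction k rule: int_induct[of _ 0])
  case base
  show ?case by (simp add: has_period_def)
next
  case (step1 i)
  then show ?case using assms has_period_add[of c "smul i u" u] by (simp add: smul_add)
next
  case (step2 i)
  have "smul (i - 1) u = smul i u + - u" using smul_add[of i "- 1" u] by simp
  then show ?case using step2 assms has_period_add has_period_uminus by metis
qed

text \<open>By Cramer's rule the multiples of \<open>cross u v\<close> in the plane belong to the
  lattice generated by \<open>u\<close> and \<open>v\<close>.\<close>
lemma has_period_lattice:
  assumes "has_period c u" "has_period c v"
  shows "has_period c (smul (cross u v) w)"
proof -
  have "smul (cross u v) w = smul (cross w v) u + smul (cross u w) v"
    by (simp add: smul_def cross_def prod_eq_iff algebra_simps)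
  then show ?thesis using assms has_period_smul has_period_add by metis
qed

text \<open>Modulo the lattice generated by \<open>p\<close> and \<open>q\<close>, the coordinates
  of \<open>b - b'\<close> can be reduced modulo \<open>cross p q\<close>.\<close>
lemma lines_come_close:
  assumes "cross p q \<noteq> 0"
  shows "\<exists>k l. (b + smul k p) - (b' + smul l q) \<in> square (nat \<bar>cross p q\<bar>)"
proof -
  define D where "D = cross p q"
  define d where "d = b - b'"
  define m where "m = (fst d div D, snd d div D)"
  have "smul D m = smul (cross m q) p + smul (cross p m) q"
    by (simp add: D_def smul_def cross_def prod_eq_iff algebra_simps)
  then have "(b + smul (- cross m q) p) - (b' + smul (cross p m) q) = d - smul D m"
    by (simp add: d_def algebra_simps)
  also have "d - smul D m = (fst d mod D, snd d mod D)"
    by (simp add: m_def smul_def prod_eq_iff minus_mult_div_eq_mod)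
  also have "\<dots> \<in> square (nat \<bar>D\<bar>)"
    using assms unfolding D_def[symmetric] square_def
    by (auto intro: less_imp_le[OF abs_mod_less])
  finally show ?thesis unfolding D_def by blast
qed

lemma parallel_common_multiple:
  assumes "cross u v = 0" "u \<noteq> 0" "v \<noteq> 0"
  shows "\<exists>j k. j \<noteq> 0 \<and> k \<noteq> 0 \<and> smul j u = smul k v"
proof (cases "fst u = 0")
  case True
  then have "snd u \<noteq> 0" "fst v = 0" "snd v \<noteq> 0"
    using assms by (auto simp: cross_def prod_eq_iff)
  with True show ?thesis
    by (intro exI[of _ "snd v"] exI[of _ "snd u"]) (simp add: smul_def)
next
  case False
  then have "fst v \<noteq> 0"
    using assms by (auto simp: cross_def prod_eq_iff)
  with False assms show ?thesis
    by (intro exI[of _ "fst v"] exI[of _ "fst u"]) (simp add: smul_def cross_def mult.commute)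
qed

text \<open>Parallel vectors are merged into a common multiple. A period may be replaced by a
  multiple, so this normalizes finite sets of periods.\<close>
lemma pairwise_nonparallel_multiples:
  assumes "finite U" "0 \<notin> U"
  shows "\<exists>V. finite V \<and> 0 \<notin> V \<and> (\<forall>u\<in>V. \<forall>v\<in>V. u \<noteq> v \<longrightarrow> cross u v \<noteq> 0) \<and>
    (\<forall>u\<in>U. \<exists>k. smul k u \<in> V)"
  using assms
proof (induction U rule: finite_induct)
  case empty
  then show ?case by (intro exI[of _ "{}"]) simp
next
  case (insert u U)
  then obtain V where V: "finite V" "0 \<notin> V" "\<forall>u\<in>V. \<forall>v\<in>V. u \<noteq> v \<longrightarrow> cross u v \<noteq> 0"
    "\<forall>u\<in>U. \<exists>k. smul k u \<in> V" by auto
  show ?case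
  proof (cases "\<exists>v\<in>V. cross u v = 0")
    case False
    then have "\<forall>v\<in>V. cross v u \<noteq> 0" using cross_swap[of u] by auto
    with False V insert.prems show ?thesis
      by (intro exI[of _ "insert u V"]) (auto intro: exI[of _ 1])
  next
    case True
    then obtain v where v: "v \<in> V" "cross u v = 0" by blast
    then obtain j k where jk: "j \<noteq> 0" "k \<noteq> 0" "smul j u = smul k v"
    proof -
      have "u \<noteq> 0" "v \<noteq> 0" using insert.prems V(2) v(1) by blast+
      then show thesis using parallel_common_multiple[OF v(2)] that by blast
    qed
    define W where "W = insert (smul k v) (V - {v})"
    have "0 \<notin> W" using V(2) v(1) jk(2) unfolding W_def by (auto simp: smul_eq_0_iff)
    moreover have "cross x y \<noteq> 0" if xy: "x \<in> W" "y \<in> W" "x \<noteq> y" for x y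
    proof -
      have *: "cross v y \<noteq> 0" "cross y v \<noteq> 0" if "y \<in> V - {v}" for y
        using V(3)[rule_format, of v y] V(3)[rule_format, of y v] v(1) that by auto
      consider "x \<in> V - {v}" "y \<in> V - {v}" | "x = smul k v" "y \<in> V - {v}"
        | "x \<in> V - {v}" "y = smul k v"
        using xy unfolding W_def by auto
      then show ?thesis
      proof cases
        case 1
        then show ?thesis using V(3)[rule_format, of x y] xy(3) by simp
      qed (use * jk(2) in \<open>simp_all add: cross_smul\<close>)
    qed
    moreover have "\<exists>i. smul i x \<in> W" if x: "x \<in> insert u U" for x
    proof (cases "x = u")
      case True
      then show ?thesis using jk unfolding W_def by (metis insertI1)
    next
      case False
      then obtain i where "smul i x \<in> V" using x V(4) by blast
      then have "smul i x \<in> W \<or> smul (k * i) x \<in> W"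
        unfolding W_def smul_smul[symmetric] by blast
      then show ?thesis by blast
    qed
    ultimately show ?thesis using V(1) by (intro exI[of _ W]) (simp add: W_def)
  qed
qed

section \<open>Local periodicity in finitely many directions\<close>

definition locally_periodic :: "nat \<Rightarrow> (int \<times> int) set \<Rightarrow> 'a config \<Rightarrow> bool" where
  "locally_periodic T U y \<longleftrightarrow> (\<forall>v. \<exists>u\<in>U. \<exists>z. has_period z u \<and> agree T (translate v y) z)"

text \<open>A cluster point of counterexamples for growing \<open>T\<close> would have both
  periods \<open>u\<close> and \<open>v\<close>, hence the period \<open>smul N w\<close>, and
  would nevertheless violate it at the origin.\<close>
lemma eventually_lattice_periodic:
  fixes u v w :: "int \<times> int"
  assumes "cross u v dvd N"
  shows "eventually (\<lambda>T. \<forall>(y :: ('a::finite) config) z z'. has_period z u \<longrightarrow> has_period z' v \<longrightarrow>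
    agree T y z \<longrightarrow> agree T y z' \<longrightarrow> y (smul N w) = y 0) sequentially"
    (is "eventually ?P _")
proof (rule ccontr)
  assume "\<not> eventually ?P sequentially"
  then have "\<forall>n. \<exists>T\<ge>n. \<not> ?P T" unfolding eventually_sequentially by blast
  then have "\<forall>n. \<exists>(y :: 'a config) z z'. has_period z u \<and> has_period z' v \<and>
    agree n y z \<and> agree n y z' \<and> y (smul N w) \<noteq> y 0"
    using agree_mono by meson
  then obtain y z z' :: "nat \<Rightarrow> 'a config" where
    y: "\<And>n. has_period (z n) u" "\<And>n. has_period (z' n) v"
      "\<And>n. agree n (y n) (z n)" "\<And>n. agree n (y n) (z' n)"
      "\<And>n. y n (smul N w) \<noteq> y n 0"
    by metis
  obtain l where l: "\<And>R m. \<exists>n\<ge>m. agree R (y n) l" using cluster_point[of y] by blast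
  have per: "has_period l p"
    if x: "\<And>n. has_period (x n) p" "\<And>n. agree n (y n) (x n)" for x p
    unfolding has_period_def
  proof
    fix a
    obtain R where R: "{a, a + p} \<subseteq> square R" using finite_subset_square[of "{a, a + p}"] by auto
    obtain n where n: "n \<ge> R" "agree R (y n) l" using l by blast
    have "agree R (y n) (x n)" using x(2) n(1) agree_mono by blast
    then have "agree R l (x n)" using n(2) agree_sym agree_trans by blast
    then show "l (a + p) = l a" using R x(1)[of n] unfolding agree_def has_period_def by simp
  qed
  have "has_period l (smul (cross u v) w')" for w'
    using has_period_lattice[OF per[OF y(1,3)] per[OF y(2,4)]] .
  moreover obtain k where k: "N = cross u v * k" using assms by blast
  ultimately have "has_period l (smul N w)" by (metis smul_smul)
  then have l0: "l (smul N w) = l 0" unfolding has_period_def by (metis add_0)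
  obtain R where R: "smul N w \<in> square R" using ex_square by blast
  obtain n where "agree R (y n) l" using l by blast
  with R l0 y(5)[of n] show False unfolding agree_def by (metis zero_in_square)
qed

text \<open>Call a position broken if a period \<open>smul N w\<close> fails there. By the choice
  of \<open>N\<close> and \<open>T\<close>, around a broken position only one direction
  \<open>u\<close> in \<open>U\<close> can describe the configuration. The local period then
  carries the break, together with its direction, to the two neighbouring positions at distance
  \<open>smul N u\<close>, and so along the whole line. If \<open>smul N u\<close> is not a period
  of the configuration, its failure somewhere starts a second line, of another direction. The two
  lines come within a bounded distance, where the breaks would have two directions.\<close>
lemma locally_periodic_imp_periodic:
  assumes U: "finite U" "0 \<notin> U" "\<And>u v. u \<in> U \<Longrightarrow> v \<in> U \<Longrightarrow> u \<noteq> v \<Longrightarrow> cross u v \<noteq> 0"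
  shows "\<exists>T N. N \<noteq> 0 \<and> (\<forall>y :: ('a::finite) config.
    locally_periodic T U y \<longrightarrow> (\<exists>u\<in>U. has_period y (smul N u)))"
proof -
  define N where "N = (\<Prod>(u,v)\<in>{(u,v)\<in>U \<times> U. u \<noteq> v}. cross u v)"
  have fin: "finite {(u,v)\<in>U \<times> U. u \<noteq> v}"
    by (rule finite_subset[of _ "U \<times> U"]) (use U(1) in auto)
  have N0: "N \<noteq> 0" unfolding N_def using fin U(3) by auto
  have Ndvd: "cross u v dvd N" if "u \<in> U" "v \<in> U" "u \<noteq> v" for u v
    unfolding N_def using fin dvd_prodI[of _ "(u,v)" "\<lambda>(u,v). cross u v"] that by auto
  have "eventually (\<lambda>T. \<forall>u\<in>U. \<forall>v\<in>U. \<forall>w\<in>U. u \<noteq> v \<longrightarrow>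
    (\<forall>(y :: 'a config) z z'. has_period z u \<longrightarrow> has_period z' v \<longrightarrow>
    agree T y z \<longrightarrow> agree T y z' \<longrightarrow> y (smul N w) = y 0)) sequentially"
  proof (intro eventually_ball_finite U(1) ballI)
    fix u v w assume "u \<in> U" "v \<in> U" "w \<in> U"
    then show "eventually (\<lambda>T. u \<noteq> v \<longrightarrow> (\<forall>(y :: 'a config) z z'. has_period z u \<longrightarrow>
        has_period z' v \<longrightarrow> agree T y z \<longrightarrow> agree T y z' \<longrightarrow> y (smul N w) = y 0)) sequentially"
      using eventually_lattice_periodic[OF Ndvd, of u v] by (cases "u = v") simp_all
  qed
  then obtain T where T: "\<And>u v w (y :: 'a config) z z'. u \<in> U \<Longrightarrow> v \<in> U \<Longrightarrow> w \<in> U \<Longrightarrow> u \<noteq> v \<Longrightarrow>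
    has_period z u \<Longrightarrow> has_period z' v \<Longrightarrow> agree T y z \<Longrightarrow> agree T y z' \<Longrightarrow> y (smul N w) = y 0"
    unfolding eventually_sequentially by blast
  have "finite (smul N ` U \<union> (\<lambda>(u,v). (cross (smul N u) (smul N v), 0)) ` (U \<times> U))"
    using U(1) by simp
  then obtain C where C: "smul N ` U \<union> (\<lambda>(u,v). (cross (smul N u) (smul N v), 0)) ` (U \<times> U)
      \<subseteq> square C"
    using finite_subset_square by metis
  have C1: "smul N u \<in> square C" if "u \<in> U" for u using C that by blast
  have C2: "square (nat \<bar>cross (smul N u) (smul N v)\<bar>) \<subseteq> square C" if "u \<in> U" "v \<in> U" for u v
  proof (rule square_mono)
    have "(cross (smul N u) (smul N v), 0) \<in> square C" using C that by blast
    then show "nat \<bar>cross (smul N u) (smul N v)\<bar> \<le> C" unfolding square_def by simp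
  qed
  have "\<exists>u\<in>U. has_period y (smul N u)" if y: "locally_periodic (T + C + C) U y" for y :: "'a config"
  proof (rule ccontr)
    assume nonper: "\<not> ?thesis"
    \<comment> \<open>Position \<open>v\<close> has kind \<open>u\<close> at scale
      \<open>S\<close> if the configuration has the local period \<open>u\<close> there.
      Positions are known to have a kind at scale \<open>T + C + C\<close>; at a broken
      position it is unique already at scale \<open>T\<close>, and the margin \<open>C\<close>
      covers the translations by periods and the gap between two lines.\<close>
    define kind where "kind S v u \<longleftrightarrow> u \<in> U \<and> (\<exists>z. has_period z u \<and> agree S (translate v y) z)" for S v u
    define brk where "brk v \<longleftrightarrow> (\<exists>w\<in>U. y (v + smul N w) \<noteq> y v)" for v
    have kind_ex: "\<exists>u. kind (T + C + C) v u" for v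
      using y unfolding locally_periodic_def kind_def by blast
    have kind_mono: "kind S' v u" if "kind S v u" "S' \<le> S" for S S' v u
      using that agree_mono unfolding kind_def by blast
    \<comment> \<open>Two kinds make the neighbourhood doubly periodic, so that nothing
      breaks.\<close>
    have kind_unique: "u = u'" if v: "brk v" "kind T v u" "kind T v u'" for v u u'
    proof (rule ccontr)
      assume ne: "u \<noteq> u'"
      obtain w where w: "w \<in> U" "y (v + smul N w) \<noteq> y v" using v(1) unfolding brk_def by blast
      have "translate v y (smul N w) = translate v y 0"
        using T[OF _ _ w(1) ne] v(2,3) unfolding kind_def by blast
      with w(2) show False by (simp add: translate_def add.commute)
    qed
    have step: "brk (v + p) \<and> kind (T + C + C) (v + p) u"
      if v: "brk v" "kind (T + C + C) v u" and p: "p = smul N u \<or> p = - smul N u" for v u p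
    proof -
      obtain z where z: "has_period z u" "agree (T + C + C) (translate v y) z" and u: "u \<in> U"
        using v unfolding kind_def by blast
      have zp: "has_period z p" using p z(1) has_period_smul has_period_uminus by blast
      have pC: "p \<in> square C" using p C1[OF u] by auto
      have val: "y (v + a) = z a" if "a \<in> square (C + C)" for a
      proof -
        have "a \<in> square (T + C + C)" using that square_mono[of "C + C" "T + C + C"] by auto
        then show ?thesis using z(2) unfolding agree_def translate_def by (simp add: add.commute)
      qed
      obtain w where w: "w \<in> U" "y (v + smul N w) \<noteq> y v" using v unfolding brk_def by blast
      have "y (v + p + smul N w) = y (v + smul N w)"
      proof -
        have "smul N w + p \<in> square (C + C)" using C1[OF w(1)] pC add_in_square by blast
        moreover have "smul N w \<in> square (C + C)" using C1[OF w(1)] square_mono[of C "C + C"] by auto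
        ultimately have "y (v + (smul N w + p)) = z (smul N w + p)" "y (v + smul N w) = z (smul N w)"
          using val by blast+
        then show ?thesis using zp[unfolded has_period_def, rule_format, of "smul N w"] by (simp add: ac_simps)
      qed
      moreover have "y (v + p) = y v"
      proof -
        have "p \<in> square (C + C)" using pC square_mono[of C "C + C"] by auto
        then have "y (v + p) = z (0 + p)" using val by simp
        then show ?thesis using zp[unfolded has_period_def, rule_format, of 0] val[of 0] by simp
      qed
      ultimately have brk: "brk (v + p)" using w unfolding brk_def by metis
      have "agree (T + C) (translate v y) z" using z(2) agree_mono[of "T + C" "T + C + C"] by simp
      then have "agree T (translate (v + p) y) z"
        using agree_translate[OF _ pC] zp unfolding has_period_iff
        by (metis add.commute translate_translate)
      then have "kind T (v + p) u" using z(1) u unfolding kind_def by blast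
      moreover obtain u' where u': "kind (T + C + C) (v + p) u'" using kind_ex by blast
      ultimately have "u = u'"
        using kind_unique[OF brk] kind_mono[OF u', of T] by simp
      with u' brk show ?thesis by simp
    qed
    have line: "brk (v + smul k (smul N u)) \<and> kind (T + C + C) (v + smul k (smul N u)) u"
      if v: "brk v" "kind (T + C + C) v u" for v u k
    proof (induction k rule: int_induct[of _ 0])
      case base
      then show ?case using v by simp
    next
      case (step1 i)
      then show ?case using step[of "v + smul i (smul N u)" u "smul N u"]
        by (simp add: smul_add add.assoc)
    next
      case (step2 i)
      have "smul (i - 1) (smul N u) = smul i (smul N u) + - smul N u"
        using smul_add[of i "- 1" "smul N u"] by simp
      then show ?case using step2 step[of "v + smul i (smul N u)" u "- smul N u"]
        by (simp add: add_diff_eq)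
    qed
    \<comment> \<open>A failure of the period \<open>smul N u\<close> itself cannot occur at a
      position of kind \<open>u\<close>.\<close>
    have brk_of: "\<exists>b. brk b \<and> (\<exists>u'. kind (T + C + C) b u' \<and> u' \<noteq> u)" if u: "u \<in> U" for u
    proof -
      obtain b where b: "y (b + smul N u) \<noteq> y b" using nonper u unfolding has_period_def by blast
      have "brk b" using b u unfolding brk_def by blast
      moreover obtain u' where u': "kind (T + C + C) b u'" using kind_ex by blast
      moreover have "u' \<noteq> u"
      proof
        assume "u' = u"
        then obtain z where z: "has_period z u" "agree (T + C + C) (translate b y) z"
          using u' unfolding kind_def by blast
        have "smul N u \<in> square (T + C + C)"
          using C1[OF u] square_mono[of C "T + C + C"] by auto
        then have "translate b y (smul N u) = z (smul N u)" "translate b y 0 = z 0"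
          using z(2) unfolding agree_def by auto
        moreover have "z (0 + smul N u) = z 0"
          using has_period_smul[OF z(1)] unfolding has_period_def by blast
        ultimately show False using b by (simp add: translate_def add.commute)
      qed
      ultimately show ?thesis by blast
    qed
    obtain u0 where "u0 \<in> U" using kind_ex[of 0] unfolding kind_def by blast
    then obtain b u where b: "brk b" "kind (T + C + C) b u" using brk_of by blast
    then have u: "u \<in> U" unfolding kind_def by blast
    then obtain b' u' where b': "brk b'" "kind (T + C + C) b' u'" "u' \<noteq> u" using brk_of by blast
    then have u': "u' \<in> U" unfolding kind_def by blast
    have "cross (smul N u) (smul N u') \<noteq> 0"
      using N0 U(3)[OF u u'] b'(3) by (simp add: cross_smul)
    then obtain k l where
      close: "(b + smul k (smul N u)) - (b' + smul l (smul N u')) \<in> square C"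
      using lines_come_close C2[OF u u'] by blast
    \<comment> \<open>The break at \<open>a\<close> has kind \<open>u\<close>, and the kind
      \<open>u'\<close> of the close position \<open>a'\<close> extends to
      \<open>a\<close>.\<close>
    define a a' where "a = b + smul k (smul N u)" and "a' = b' + smul l (smul N u')"
    have a: "brk a" "kind (T + C + C) a u" using line[OF b] unfolding a_def by auto
    have "kind (T + C + C) a' u'" using line[OF b'(1,2)] unfolding a'_def by auto
    then obtain z where z: "has_period z u'" "agree (T + C + C) (translate a' y) z"
      unfolding kind_def by blast
    have "agree (T + C) (translate a' y) z" using z(2) agree_mono[of "T + C" "T + C + C"] by simp
    then have "agree T (translate a y) (translate (a - a') z)"
      using agree_translate[of T C "translate a' y" z "a - a'"] close unfolding a_def a'_def by simp
    then have "kind T a u'" using z(1) u' unfolding kind_def by (metis has_period_translate)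
    with kind_unique[OF a(1) _ this] kind_mono[OF a(2), of T] b'(3) show False by simp
  qed
  then show ?thesis using N0 by blast
qed

definition finitely_many_periods :: "'a config set \<Rightarrow> bool" where
  "finitely_many_periods Z \<longleftrightarrow> (\<exists>U. finite U \<and> 0 \<notin> U \<and> (\<forall>z\<in>Z. \<exists>u\<in>U. has_period z u))"

lemma finitely_many_periods_loc:
  fixes Z :: "('a::finite) config set"
  assumes "finitely_many_periods Z"
  shows "\<exists>T. \<forall>A. A \<subseteq> loc T Z \<longrightarrow> finitely_many_periods A"
proof -
  obtain U where U: "finite U" "0 \<notin> U" "\<forall>z\<in>Z. \<exists>u\<in>U. has_period z u"
    using assms unfolding finitely_many_periods_def by blast
  obtain V where V: "finite V" "0 \<notin> V" "\<And>u v. u \<in> V \<Longrightarrow> v \<in> V \<Longrightarrow> u \<noteq> v \<Longrightarrow> cross u v \<noteq> 0"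
    and UV: "\<forall>u\<in>U. \<exists>k. smul k u \<in> V"
    using pairwise_nonparallel_multiples[OF U(1,2)] by blast
  have ZV: "\<exists>v\<in>V. has_period z v" if "z \<in> Z" for z
    using U(3) UV that has_period_smul by blast
  obtain T N where TN: "N \<noteq> 0"
    "\<And>y :: 'a config. locally_periodic T V y \<Longrightarrow> \<exists>u\<in>V. has_period y (smul N u)"
    using locally_periodic_imp_periodic[OF V, where 'a = 'a] by blast
  have "finitely_many_periods A" if "A \<subseteq> loc T Z" for A
    unfolding finitely_many_periods_def
  proof (intro exI[of _ "smul N ` V"] conjI ballI)
    show "0 \<notin> smul N ` V" using V(2) TN(1) smul_eq_0_iff by (metis imageE)
    fix y assume "y \<in> A"
    then have "y \<in> loc T Z" using that by blast
    then have "locally_periodic T V y"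
      unfolding locally_periodic_def
    proof (intro allI)
      show "\<exists>u\<in>V. \<exists>z. has_period z u \<and> agree T (translate v y) z" for v
      proof -
        obtain z where z: "z \<in> Z" "agree T (translate v y) z"
          using \<open>y \<in> loc T Z\<close> unfolding loc_def by blast
        then show ?thesis using ZV[OF z(1)] by blast
      qed
    qed
    then show "\<exists>u\<in>smul N ` V. has_period y u" using TN(2) by blast
  qed (use V(1) in simp)
  then show ?thesis by blast
qed

lemma countable_subshift_finitely_many_periods:
  fixes Y :: "('a::finite) config set"
  assumes "subshift Y" "countable Y" "\<And>y. y \<in> Y \<Longrightarrow> \<exists>u. u \<noteq> 0 \<and> has_period y u"
  shows "finitely_many_periods Y"
proof (rule countable_subshift_induct[OF assms(1,2)])
  show "finitely_many_periods ({} :: 'a config set)" unfolding finitely_many_periods_def by auto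
  show "finitely_many_periods (A \<union> orbit a)" if A: "finitely_many_periods A" and a: "a \<in> Y" for A a
  proof -
    obtain U where U: "finite U" "0 \<notin> U" "\<forall>z\<in>A. \<exists>u\<in>U. has_period z u"
      using A unfolding finitely_many_periods_def by blast
    obtain u where u: "u \<noteq> 0" "has_period a u" using assms(3)[OF a] by metis
    have "\<forall>z\<in>orbit a. has_period z u" using u(2) unfolding orbit_def by simp
    with U(3) have "\<forall>z\<in>A \<union> orbit a. \<exists>u\<in>insert u U. has_period z u" by blast
    with U(1,2) u(1) show ?thesis unfolding finitely_many_periods_def
      by (metis finite_insert insertE)
  qed
  show "\<exists>T. \<forall>A. A \<subseteq> loc T Z \<longrightarrow> finitely_many_periods A"
    if "finitely_many_periods Z" for Z :: "'a config set"
    using that by (rule finitely_many_periods_loc)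
qed

text \<open>That \<open>smul k e\<close> is a period can be read off from patterns whose size
  depends only on \<open>k\<close>; this makes the property local.\<close>
lemma countable_subshift_common_period:
  fixes Y :: "('a::finite) config set"
  assumes "subshift Y" "countable Y" "\<And>y. y \<in> Y \<Longrightarrow> \<exists>k>0. has_period y (smul k e)"
  shows "\<exists>k>0. \<forall>y\<in>Y. has_period y (smul k e)"
proof (rule countable_subshift_induct[OF assms(1,2)])
  show "\<exists>k>0. \<forall>y\<in>{} :: 'a config set. has_period y (smul k e)" by (intro exI[of _ 1]) simp
  show "\<exists>k>0. \<forall>y\<in>A \<union> orbit a. has_period y (smul k e)"
    if A: "\<exists>k>0. \<forall>y\<in>A. has_period y (smul k e)" and a: "a \<in> Y" for A a
  proof -
    obtain k where k: "k > 0" "\<And>y. y \<in> A \<Longrightarrow> has_period y (smul k e)" using A by blast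
    obtain j where j: "j > 0" "has_period a (smul j e)" using assms(3) a by blast
    have "has_period y (smul (j * k) e)" if "y \<in> A" for y
      using has_period_smul[OF k(2)[OF that]] by (simp add: smul_smul)
    moreover have "has_period y (smul (j * k) e)" if "y \<in> orbit a" for y
      using has_period_smul[OF j(2), of k] that by (auto simp: orbit_def smul_smul mult.commute)
    ultimately show ?thesis using k(1) j(1) by (intro exI[of _ "j * k"]) auto
  qed
  show "\<exists>T. \<forall>A. A \<subseteq> loc T Z \<longrightarrow> (\<exists>k>0. \<forall>y\<in>A. has_period y (smul k e))"
    if Z: "\<exists>k>0. \<forall>y\<in>Z. has_period y (smul k e)" for Z :: "'a config set"
  proof -
    obtain k where k: "k > 0" "\<And>y. y \<in> Z \<Longrightarrow> has_period y (smul k e)" using Z by blast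
    obtain T where T: "smul k e \<in> square T" using ex_square by blast
    have "has_period y (smul k e)" if y: "y \<in> loc T Z" for y
      unfolding has_period_def
    proof
      fix a
      obtain z where z: "z \<in> Z" "agree T (translate a y) z" using y unfolding loc_def by blast
      have "translate a y (smul k e) = z (0 + smul k e)" using z(2) T unfolding agree_def by simp
      also have "\<dots> = z 0" using k(2)[OF z(1)] unfolding has_period_def by blast
      also have "\<dots> = translate a y 0" using z(2) unfolding agree_def by simp
      finally show "y (a + smul k e) = y a" by (simp add: translate_def add.commute)
    qed
    then show ?thesis using k(1) by blast
  qed
qed

section \<open>The pattern preorder and subshifts of finite type\<close>

lemma appears_translate [simp]: "appears P (translate v c) \<longleftrightarrow> appears P c"
proof -
  have "appears P c" if "appears P (translate v c)" for v c
    using that unfolding appears_def translate_def by (metis add.assoc)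
  from this[of v c] this[of "- v" "translate v c"] show ?thesis by auto
qed

lemma pat_le_iff_agree: "x \<preceq> y \<longleftrightarrow> (\<forall>R. \<exists>v. agree R (translate v y) x)"
proof
  assume le: "x \<preceq> y"
  show "\<forall>R. \<exists>v. agree R (translate v y) x"
  proof
    fix R
    define P where "P = (\<lambda>a. if a \<in> square R then Some (x a) else None)"
    have dom: "dom P = square R" unfolding P_def by (auto split: if_splits)
    have "appears P x" unfolding appears_def dom by (intro exI[of _ 0]) (simp add: P_def)
    then have "appears P y" using le dom finite_square unfolding pat_le_def is_pattern_def by metis
    then show "\<exists>v. agree R (translate v y) x"
      unfolding appears_def dom agree_def translate_def by (auto simp: P_def)
  qed
next
  assume agr: "\<forall>R. \<exists>v. agree R (translate v y) x"
  show "x \<preceq> y"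
    unfolding pat_le_def
  proof (intro allI impI)
    fix P assume P: "is_pattern P" "appears P x"
    then obtain v where v: "\<And>a. a \<in> dom P \<Longrightarrow> P a = Some (x (a + v))" unfolding appears_def by blast
    obtain R where R: "(\<lambda>a. a + v) ` dom P \<subseteq> square R"
      using P(1) finite_subset_square unfolding is_pattern_def by blast
    obtain w where w: "agree R (translate w y) x" using agr by blast
    have "P a = Some (translate w y (a + v))" if a: "a \<in> dom P" for a
    proof -
      have "a + v \<in> square R" using R a by blast
      then show ?thesis using v[OF a] agreeD[OF w, of "a + v"] by simp
    qed
    then show "appears P y" unfolding appears_def translate_def by (metis add.assoc)
  qed
qed

lemma pat_le_refl [simp]: "x \<preceq> x"
  unfolding pat_le_def by blast

lemma pat_le_trans: "x \<preceq> y \<Longrightarrow> y \<preceq> z \<Longrightarrow> x \<preceq> z"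
  unfolding pat_le_def by blast

lemma pat_le_translate [simp]: "translate v x \<preceq> y \<longleftrightarrow> x \<preceq> y" "x \<preceq> translate v y \<longleftrightarrow> x \<preceq> y"
  unfolding pat_le_def by simp_all

lemma pat_less_iff: "x \<prec> y \<longleftrightarrow> x \<preceq> y \<and> \<not> y \<preceq> x"
  unfolding pat_less_def pat_equiv_def by blast

lemma orbit_pat_le: "x \<in> orbit y \<Longrightarrow> y \<preceq> x"
  unfolding orbit_def by auto

lemma subshift_below: "subshift {x. x \<preceq> y}"
  unfolding subshift_def
proof (intro conjI ballI allI impI)
  fix x assume x: "\<forall>R. \<exists>z\<in>{x. x \<preceq> y}. agree R z x"
  have "\<exists>v. agree R (translate v y) x" for R
  proof -
    obtain z where z: "z \<preceq> y" "agree R z x" using x by blast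
    then obtain v where "agree R (translate v y) z" unfolding pat_le_iff_agree by blast
    then show ?thesis using z(2) agree_trans by blast
  qed
  then show "x \<in> {x. x \<preceq> y}" unfolding pat_le_iff_agree by blast
qed simp

text \<open>Every \<open>x\<close> below \<open>y\<close> is a limit of translates of
  \<open>y\<close>.\<close>
lemma subshift_downward_closed:
  assumes "subshift Z" "y \<in> Z" "x \<preceq> y"
  shows "x \<in> Z"
  by (rule subshift_limit[OF assms(1)])
    (use assms(3) subshift_translate[OF assms(1,2)] pat_le_iff_agree in blast)

lemma SFT_subshift:
  assumes "is_SFT X"
  shows "subshift X"
proof -
  obtain F where F: "\<forall>P\<in>F. is_pattern P" "X = subshift_of F" using assms unfolding is_SFT_def by blast
  show ?thesis
    unfolding subshift_def
  proof (intro conjI ballI allI impI)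
    show "translate v z \<in> X" if "z \<in> X" for z v
      using that unfolding F(2) subshift_of_def by simp
    fix y assume y: "\<forall>R. \<exists>z\<in>X. agree R z y"
    have "\<not> appears P y" if P: "P \<in> F" for P
    proof
      assume "appears P y"
      then obtain v where v: "\<forall>a\<in>dom P. P a = Some (y (a + v))" unfolding appears_def by blast
      obtain R where R: "(\<lambda>a. a + v) ` dom P \<subseteq> square R"
        using P F(1) finite_subset_square unfolding is_pattern_def by blast
      obtain z where z: "z \<in> X" "agree R z y" using y by blast
      then have "z (a + v) = y (a + v)" if "a \<in> dom P" for a
        using R that by (intro agreeD[of R]) auto
      then have "\<forall>a\<in>dom P. P a = Some (z (a + v))" using v by simp
      then have "appears P z" unfolding appears_def by blast
      with z(1) P show False unfolding F(2) subshift_of_def by blast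
    qed
    then show "y \<in> X" unfolding F(2) subshift_of_def by blast
  qed
qed

text \<open>Any \<open>W\<close> such that the square of radius \<open>W\<close> contains the
  domains of the finitely many forbidden patterns will do. This is how the finite type of
  \<open>X\<close> enters: a configuration assembled from pieces of elements of \<open>X\<close>
  that overlap by \<open>W\<close> belongs to \<open>X\<close>.\<close>
lemma SFT_loc:
  assumes "is_SFT X"
  shows "\<exists>W. loc W X \<subseteq> X"
proof -
  obtain F where F: "finite F" "\<forall>P\<in>F. is_pattern P" "X = subshift_of F"
    using assms unfolding is_SFT_def by blast
  have "finite (\<Union>P\<in>F. dom P)" using F(1,2) unfolding is_pattern_def by blast
  then obtain W where W: "(\<Union>P\<in>F. dom P) \<subseteq> square W" using finite_subset_square by blast
  have "c \<in> X" if c: "c \<in> loc W X" for c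
  proof -
    have "\<not> appears P c" if P: "P \<in> F" for P
    proof
      assume "appears P c"
      then obtain v where v: "\<forall>a\<in>dom P. P a = Some (c (a + v))" unfolding appears_def by blast
      obtain z where z: "z \<in> X" "agree W (translate v c) z" using c unfolding loc_def by blast
      have "translate v c a = z a" if "a \<in> dom P" for a
        using z(2) W P that by (intro agreeD[of W]) auto
      then have "\<forall>a\<in>dom P. P a = Some (z (a + 0))" using v by (simp add: translate_def)
      then have "appears P z" unfolding appears_def by blast
      with z(1) P show False unfolding F(3) subshift_of_def by blast
    qed
    then show ?thesis unfolding F(3) subshift_of_def by blast
  qed
  then show ?thesis by blast
qed

lemma doubly_periodic_finite_orbit:
  assumes "has_period x u" "has_period x v" "cross u v \<noteq> 0"
  shows "finite (orbit x)"
proof (rule finite_subset)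
  define D where "D = cross u v"
  show "orbit x \<subseteq> (\<lambda>w. translate w x) ` square (nat \<bar>D\<bar>)"
  proof
    fix y assume "y \<in> orbit x"
    then obtain w where w: "y = translate w x" unfolding orbit_def by blast
    define m where "m = (fst w div D, snd w div D)"
    define r where "r = (fst w mod D, snd w mod D)"
    have "w = r + smul D m" by (simp add: m_def r_def smul_def prod_eq_iff)
    moreover have "translate (smul D m) x = x"
      using has_period_lattice[OF assms(1,2)] unfolding has_period_iff D_def .
    ultimately have "y = translate r x" unfolding w by (metis translate_translate)
    moreover have "r \<in> square (nat \<bar>D\<bar>)"
      using assms(3) unfolding D_def[symmetric] square_def r_def
      by (auto intro: less_imp_le[OF abs_mod_less])
    ultimately show "y \<in> (\<lambda>w. translate w x) ` square (nat \<bar>D\<bar>)" by blast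
  qed
qed (simp add: finite_square)

text \<open>A large enough pattern distinguishes a configuration from each of the finitely many
  translates of \<open>x\<close>, so \<open>y\<close> is itself one of them.\<close>
lemma finite_orbit_minimal:
  assumes "finite (orbit x)" "y \<preceq> x"
  shows "x \<preceq> y"
proof -
  have "y \<in> orbit x"
  proof (rule ccontr)
    assume y: "y \<notin> orbit x"
    have "eventually (\<lambda>R. \<forall>z\<in>orbit x. \<not> agree R z y) sequentially"
    proof (intro eventually_ball_finite assms(1) ballI)
      fix z assume "z \<in> orbit x"
      with y have "z \<noteq> y" by blast
      then obtain S where "\<not> agree S z y" using agree_all_eq by blast
      then show "eventually (\<lambda>R. \<not> agree R z y) sequentially"
        using agree_mono unfolding eventually_sequentially by blast
    qed
    then obtain R where "\<forall>z\<in>orbit x. \<not> agree R z y" unfolding eventually_sequentially by blast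
    with assms(2) show False unfolding pat_le_iff_agree orbit_def by blast
  qed
  then show ?thesis by (rule orbit_pat_le)
qed

text \<open>By minimality every cluster point \<open>l\<close> of the translates of
  \<open>x\<close> along \<open>e\<close> has the isolated configuration \<open>a\<close> below
  it, hence, by isolation, among its translates. Then infinitely many of the translates of
  \<open>x\<close> coincide.\<close>
lemma minimal_has_period:
  fixes x :: "('a::finite) config"
  assumes "countable {y. y \<preceq> x}" and min: "\<And>y. y \<preceq> x \<Longrightarrow> x \<preceq> y"
  shows "\<exists>k>0. has_period x (smul k e)"
proof -
  define f where "f n = translate (smul (int n) e) x" for n
  have "x \<in> {y. y \<preceq> x}" by simp
  then have "{y. y \<preceq> x} \<noteq> {}" by blast
  then obtain a R where iso: "isolated_in {y. y \<preceq> x} R a"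
    using countable_subshift_isolated[OF subshift_below assms(1)] by metis
  then have "a \<preceq> x" unfolding isolated_in_def by blast
  obtain l where l: "\<And>R m. \<exists>n\<ge>m. agree R (f n) l" using cluster_point[of f] by blast
  have "l \<in> {y. y \<preceq> x}"
  proof (rule subshift_limit[OF subshift_below])
    fix R
    obtain n where "agree R (f n) l" using l by blast
    moreover have "f n \<preceq> x" unfolding f_def by simp
    ultimately show "\<exists>z\<in>{y. y \<preceq> x}. agree R z l" by blast
  qed
  then have "l \<preceq> x" by simp
  then have "a \<preceq> l" using \<open>a \<preceq> x\<close> min pat_le_trans by blast
  then obtain v where v: "agree R (translate v l) a" unfolding pat_le_iff_agree by blast
  obtain S where S: "v \<in> square S" using ex_square by blast
  have eq: "translate v (f n) = a" if "agree (R + S) (f n) l" for n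
  proof -
    have "agree R (translate v (f n)) a" using agree_translate[OF that S] v agree_trans by blast
    moreover have "translate v (f n) \<preceq> x" unfolding f_def by simp
    ultimately show ?thesis using iso unfolding isolated_in_def by blast
  qed
  obtain n where n: "agree (R + S) (f n) l" using l by blast
  obtain m where m: "m \<ge> Suc n" "agree (R + S) (f m) l" using l by blast
  have "f n = f m" using eq[OF n] eq[OF m(2)] by (metis translate_eq_iff)
  then have "x = translate (smul (int m) e - smul (int n) e) x"
    unfolding f_def by (simp add: translate_eq_iff)
  moreover have "smul (int m) e - smul (int n) e = smul (int m - int n) e"
    by (simp add: smul_def prod_eq_iff algebra_simps)
  ultimately have "has_period x (smul (int m - int n) e)" unfolding has_period_iff by simp
  then show ?thesis using m(1) by (intro exI[of _ "int m - int n"]) auto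
qed

lemma uncountable_if_encodes_sets:
  assumes "inj (f :: nat set \<Rightarrow> 'b)" "range f \<subseteq> X"
  shows "\<not> countable X"
proof
  assume "countable X"
  then have "countable (range f)" using assms(2) countable_subset by blast
  then have "countable (UNIV :: nat set set)" using assms(1) by (simp add: countable_image_inj_eq)
  then have "range (from_nat_into (UNIV :: nat set set)) = UNIV" by (simp add: range_from_nat_into)
  then show False using Cantors_theorem[of "UNIV :: nat set"] by (metis Pow_UNIV)
qed

section \<open>Finite defects\<close>

text \<open>From a point outside the square one can move freely by multiples of \<open>N\<close>
  along the coordinate whose axis direction avoids the square, out to a far position, and from
  there along the other coordinate.\<close>
lemma periodic_outside_square:
  fixes a :: "'a config" and N :: int
  assumes N: "N > 0"
    and h: "\<And>v. v \<notin> square K \<Longrightarrow> a (v + (N, 0)) = a v"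
    and v: "\<And>v. v \<notin> square K \<Longrightarrow> a (v + (0, N)) = a v"
    and out: "(i, j) \<notin> square K"
    and L: "L > int K div N"
  shows "a (i, j) = a (i mod N + N * L, j mod N + N * L)"
proof -
  have horizontal: "a (i + k * N, j) = a (i, j)" if "\<bar>j\<bar> > int K" for i j k
  proof (induction k rule: int_induct[of _ 0])
    case (step1 k)
    then show ?case using h[of "(i + k * N, j)"] that by (simp add: square_def algebra_simps)
  next
    case (step2 k)
    then show ?case using h[of "(i + (k - 1) * N, j)"] that by (simp add: square_def algebra_simps)
  qed simp
  have vertical: "a (i, j + k * N) = a (i, j)" if "\<bar>i\<bar> > int K" for i j k
  proof (induction k rule: int_induct[of _ 0])
    case (step1 k)
    then show ?case using v[of "(i, j + k * N)"] that by (simp add: square_def algebra_simps)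
  next
    case (step2 k)
    then show ?case using v[of "(i, j + (k - 1) * N)"] that by (simp add: square_def algebra_simps)
  qed simp
  have far: "\<bar>m mod N + N * L\<bar> > int K" for m
  proof -
    have "N * (int K div N + 1) \<le> N * L" using N L by (intro mult_left_mono) auto
    moreover have "N * (int K div N + 1) > int K"
      using N by (simp add: algebra_simps) (metis add.commute add_less_cancel_left mult.commute mult_div_mod_eq pos_mod_bound)
    ultimately show ?thesis using pos_mod_sign[OF N, of m] by linarith
  qed
  have red: "m mod N + N * L = m + (L - m div N) * N" for m
    using mult_div_mod_eq[of N m] by (simp add: algebra_simps)
  show ?thesis
  proof (cases "\<bar>i\<bar> > int K")
    case True
    have "a (i, j) = a (i, j mod N + N * L)" using vertical[OF True] by (simp only: red)
    also have "\<dots> = a (i mod N + N * L, j mod N + N * L)"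
      using horizontal[OF far] by (simp only: red[of i])
    finally show ?thesis .
  next
    case False
    then have j: "\<bar>j\<bar> > int K" using out by (simp add: square_def)
    have "a (i, j) = a (i mod N + N * L, j)" using horizontal[OF j] by (simp only: red)
    also have "\<dots> = a (i mod N + N * L, j mod N + N * L)"
      using vertical[OF far] by (simp only: red[of j])
    finally show ?thesis .
  qed
qed

text \<open>The background \<open>q\<close> is the doubly periodic configuration that agrees with
  \<open>a\<close> outside the square; the defect is the difference between \<open>a\<close> and
  \<open>q\<close>. Copies of the defect are placed at distance \<open>D\<close> along an axis, at
  the indices of an arbitrary set \<open>S\<close> of natural numbers. A window of radius
  \<open>W\<close> meets at most one of them, so it shows a pattern of \<open>a\<close>.\<close>
lemma finite_defect_uncountable:
  fixes X :: "'a config set" and N :: int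
  assumes X: "subshift X" "loc W X \<subseteq> X" "a \<in> X"
    and N: "N > 0"
    and h: "\<And>v. v \<notin> square K \<Longrightarrow> a (v + (N, 0)) = a v"
    and v: "\<And>v. v \<notin> square K \<Longrightarrow> a (v + (0, N)) = a v"
    and defect: "\<not> has_period a (N, 0) \<or> \<not> has_period a (0, N)"
  shows "\<not> countable X"
proof -
  \<comment> \<open>Large enough for the representatives modulo \<open>N\<close> shifted by
    \<open>N * L\<close> to lie outside the square.\<close>
  define L where "L = int K div N + 1"
  define q where "q = (\<lambda>v. a (fst v mod N + N * L, snd v mod N + N * L))"
  have aq: "a v = q v" if "v \<notin> square K" for v
    using periodic_outside_square[OF N h v, where i = "fst v" and j = "snd v" and L = L] that
    unfolding q_def L_def by simp
  have q_h: "q (v + (m * N, 0)) = q v" for v m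
    unfolding q_def by simp
  have q_v: "q (v + (0, m * N)) = q v" for v m
    unfolding q_def by simp
  have "\<exists>d. a d \<noteq> q d"
  proof (rule ccontr)
    assume "\<not> ?thesis"
    then have "a = q" by auto
    then show False using defect q_h[of _ 1] q_v[of _ 1] unfolding has_period_def by simp
  qed
  then obtain d where d: "a d \<noteq> q d" by blast
  have dK: "d \<in> square K" using d aq by blast
  \<comment> \<open>A window of radius \<open>W\<close> fits between squares of radius
    \<open>K\<close> at this distance.\<close>
  define M where "M = 2 * int K + 2 * int W + 1"
  define D where "D = M * N"
  have MD: "M \<le> D" using N unfolding D_def M_def by (simp add: mult_le_cancel_left1)
  have qD: "q (v - (i * D, 0)) = q v" for v i
    using q_h[of v "- i * M"] unfolding D_def by (simp add: algebra_simps minus_prod_def plus_prod_def)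
  define slab where "slab v = (fst v + int K) div D" for v :: "int \<times> int"
  define y where "y S = (\<lambda>v. (if slab v \<in> int ` S then a else q) (v - (slab v * D, 0)))" for S
  have slab_bounds: "slab v * D \<le> fst v + int K" "fst v + int K < slab v * D + D" for v
  proof -
    have "D > 0" using MD unfolding M_def by linarith
    then show "slab v * D \<le> fst v + int K" "fst v + int K < slab v * D + D"
      unfolding slab_def
      using minus_mod_eq_div_mult[of "fst v + int K" D]
        pos_mod_bound[of D "fst v + int K"] pos_mod_sign[of D "fst v + int K"]
      by linarith+
  qed
  \<comment> \<open>Near the edges of the slab \<open>i\<close> the description by the slab
    \<open>i\<close> stays valid in the defect-free part of the slab before it.\<close>
  have y_eq: "y S v = (if i \<in> int ` S then a else q) (v - (i * D, 0))"
    if b: "fst v \<le> i * D - int K - 1 + D" "i * D - D + int K < fst v" for S v i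
  proof (cases "slab v = i")
    case True
    then show ?thesis unfolding y_def by simp
  next
    case False
    have "slab v = i - 1"
    proof -
      have "slab v * D < (i + 1) * D" using b slab_bounds[of v] by (simp add: algebra_simps)
      moreover have "(i - 2) * D < slab v * D"
        using b slab_bounds[of v] by (simp add: algebra_simps)
      moreover have "D > 0" using MD unfolding M_def by linarith
      ultimately have "slab v < i + 1" "i - 2 < slab v" by simp_all
      with False show ?thesis by linarith
    qed
    then have "slab v * D = i * D - D" by (simp add: left_diff_distrib)
    then have lt: "fst v + int K < i * D" and gt: "int K < fst v - slab v * D"
      using slab_bounds[of v] b by linarith+
    have "v - (i * D, 0) \<notin> square K" "v - (slab v * D, 0) \<notin> square K"
      using lt gt unfolding square_def by auto
    then have "y S v = q v" "(if i \<in> int ` S then a else q) (v - (i * D, 0)) = q v"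
      unfolding y_def by (simp_all add: aq qD)
    then show ?thesis by simp
  qed
  have "y S \<in> loc W X" for S
    unfolding loc_def
  proof (intro CollectI allI)
    fix v :: "int \<times> int"
    define i where "i = slab (v + (int W, 0))"
    have ball: "y S (b + v) = (if i \<in> int ` S then a else q) (b + v - (i * D, 0))"
      if "b \<in> square W" for b
      using slab_bounds[of "v + (int W, 0)"] that MD
      by (intro y_eq) (auto simp: i_def[symmetric] square_def M_def algebra_simps)
    show "\<exists>z\<in>X. agree W (translate v (y S)) z"
    proof (cases "i \<in> int ` S")
      case True
      then have "agree W (translate v (y S)) (translate (v - (i * D, 0)) a)"
        unfolding agree_def translate_def using ball by (simp add: algebra_simps)
      then show ?thesis using subshift_translate[OF X(1,3)] by blast
    next
      case False
      \<comment> \<open>A window without defect occurs in \<open>a\<close> far from the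
        square.\<close>
      define m where "m = \<bar>fst v\<bar> + int W + int K + 1"
      have "a (b + (v + (m * N, 0))) = q (b + v)" if "b \<in> square W" for b
      proof -
        have "m * 1 \<le> m * N" using N unfolding m_def by (intro mult_left_mono) auto
        moreover have "\<bar>fst b\<bar> \<le> int W" using that unfolding square_def by simp
        ultimately have "int K < fst b + (fst v + m * N)"
          using abs_ge_minus_self[of "fst b"] abs_ge_minus_self[of "fst v"] m_def by linarith
        then have "b + (v + (m * N, 0)) \<notin> square K" unfolding square_def by simp
        then show ?thesis using aq q_h[of "b + v" m] by (simp add: add.assoc)
      qed
      then have "agree W (translate v (y S)) (translate (v + (m * N, 0)) a)"
        unfolding agree_def translate_def using ball False by (simp add: qD)
      then show ?thesis using subshift_translate[OF X(1,3)] by blast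
    qed
  qed
  then have "range y \<subseteq> X" using X(2) by blast
  moreover have "inj y"
  proof (rule injI)
    fix S S' assume eq: "y S = y S'"
    have "n \<in> T \<longleftrightarrow> y T (d + (int n * D, 0)) = a d" for n T
    proof -
      have "y T (d + (int n * D, 0)) =
          (if int n \<in> int ` T then a else q) (d + (int n * D, 0) - (int n * D, 0))"
        using dK MD by (intro y_eq) (auto simp: square_def M_def)
      then show ?thesis using d by (auto simp: inj_image_mem_iff)
    qed
    from this[of _ S] this[of _ S'] show "S = S'" unfolding eq by blast
  qed
  ultimately show ?thesis using uncountable_if_encodes_sets by blast
qed

section \<open>Configurations with a period\<close>

text \<open>The functions \<open>s'\<close> are the bi-infinite walks in the graph whose edges are
  the pairs of consecutive values of \<open>s\<close>. Some value \<open>\<beta>\<close> recurs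
  forever. Let \<open>a < b < d\<close> be occurrences of it. The closed walk \<open>A\<close>
  from \<open>a\<close> to \<open>d\<close> and the closed walk \<open>B\<close>, which runs from
  \<open>b\<close> to \<open>d\<close> and then from \<open>a\<close> to \<open>b\<close>, have
  the same length. If they differ, concatenating them in all possible ways gives uncountably many
  walks. If they agree, then \<open>s (j + (b - a)) = s j\<close> for \<open>j\<close> between
  \<open>a\<close> and \<open>d - (b - a)\<close>; and \<open>d\<close> can be chosen arbitrarily
  large.\<close>
lemma walk_eventually_periodic:
  fixes s :: "int \<Rightarrow> 'b"
  assumes fin: "finite (range s)"
    and count: "countable {s'. \<forall>j::int. \<exists>k. s' j = s k \<and> s' (j + 1) = s (k + 1)}"
  shows "\<exists>m>0. \<exists>K. \<forall>j\<ge>K. s (j + m) = s j"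
proof (rule ccontr)
  assume neg: "\<not> ?thesis"
  have "finite ((\<lambda>n. s (int n)) ` UNIV)" by (rule finite_subset[OF _ fin]) auto
  then obtain n0 where inf: "infinite {n\<in>UNIV. s (int n) = s (int n0)}"
    using pigeonhole_infinite[of "UNIV :: nat set" "\<lambda>n. s (int n)"] by auto
  define \<beta> where "\<beta> = s (int n0)"
  have recur: "\<exists>b. b > x \<and> s b = \<beta>" for x :: int
  proof -
    obtain n where "n > nat x" "s (int n) = \<beta>"
      using inf unfolding infinite_nat_iff_unbounded \<beta>_def by auto
    then show ?thesis by (intro exI[of _ "int n"]) auto
  qed
  obtain a where a: "s a = \<beta>" using recur by blast
  obtain b where b: "b > a" "s b = \<beta>" using recur by blast
  have "\<not> (\<forall>j\<ge>a. s (j + (b - a)) = s j)" using neg b(1) by (metis diff_gt_0_iff_gt)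
  then obtain j0 where j0: "j0 \<ge> a" "s (j0 + (b - a)) \<noteq> s j0" by blast
  \<comment> \<open>Beyond \<open>j0 + (b - a)\<close>, so that \<open>A\<close> and
    \<open>B\<close> are long enough to show the difference at \<open>j0\<close>.\<close>
  obtain d where d: "d > j0 + (b - a)" "s d = \<beta>" using recur by blast
  define l where "l = d - a"
  define A where "A = (\<lambda>i. s (a + i))"
  define B where "B = (\<lambda>i. if i < d - b then s (b + i) else s (a + i - (d - b)))"
  have l: "l > 0" using b d j0 unfolding l_def by linarith
  define edge where "edge r r' \<longleftrightarrow> (\<exists>k. r = s k \<and> r' = s (k + 1))" for r r'
  have edgeI: "edge (s k) (s (k + 1))" for k unfolding edge_def by blast
  have A_edge: "edge (A i) (A (i + 1))" for i
    using edgeI[of "a + i"] unfolding A_def by (simp add: add.assoc)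
  have B_edge: "edge (B i) (B (i + 1))" for i
  proof -
    consider "i + 1 < d - b" | "i + 1 = d - b" | "i \<ge> d - b" by linarith
    then show ?thesis
    proof cases
      case 1
      then show ?thesis using edgeI[of "b + i"] unfolding B_def by (simp add: add.assoc)
    next
      case 2
      then have "B i = s (b + i)" "B (i + 1) = s a" "b + i + 1 = d" unfolding B_def by auto
      then show ?thesis using edgeI[of "b + i"] a d(2) by simp
    next
      case 3
      then have "B i = s (a + i - (d - b))" "B (i + 1) = s (a + i - (d - b) + 1)"
        unfolding B_def by (auto simp: algebra_simps)
      then show ?thesis using edgeI by simp
    qed
  qed
  have start: "A 0 = \<beta>" "B 0 = \<beta>" using a b d j0 unfolding A_def B_def by auto
  have last: "edge (A (l - 1)) \<beta>" "edge (B (l - 1)) \<beta>"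
  proof -
    show "edge (A (l - 1)) \<beta>" using edgeI[of "d - 1"] d(2) unfolding A_def l_def by simp
    have "B (l - 1) = s (b - 1)" using b(1) unfolding B_def l_def by (simp add: algebra_simps)
    then show "edge (B (l - 1)) \<beta>" using edgeI[of "b - 1"] b(2) by simp
  qed
  \<comment> \<open>Before time 0 the walk \<open>s\<close> leading to \<open>a\<close>,
    afterwards blocks \<open>A\<close> and \<open>B\<close> as prescribed by
    \<open>S\<close>.\<close>
  define w where "w S j = (if j < 0 then s (a + j)
      else (if j div l \<in> int ` S then B else A) (j mod l))" for S j
  have w_edge: "edge (w S j) (w S (j + 1))" for S j
  proof -
    consider "j + 1 < 0" | "j + 1 = 0" | "j \<ge> 0" "j mod l + 1 < l" | "j \<ge> 0" "j mod l + 1 = l"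
      using pos_mod_bound[OF l, of j] by linarith
    then show ?thesis
    proof cases
      case 1
      then show ?thesis using edgeI[of "a + j"] unfolding w_def by (simp add: add.assoc)
    next
      case 2
      then have "w S (j + 1) = \<beta>" using start unfolding w_def by simp
      also have "j = - 1" using 2 by simp
      then have "\<beta> = s (a + j + 1)" using a by simp
      finally have "w S (j + 1) = s (a + j + 1)" .
      moreover have "w S j = s (a + j)" using 2 unfolding w_def by simp
      ultimately show ?thesis using edgeI by simp
    next
      case 3
      define r where "r = j mod l"
      define q where "q = j div l"
      have jq: "j + 1 = q * l + (r + 1)" unfolding r_def q_def by simp
      have r: "0 \<le> r + 1" "r + 1 < l" using 3 l unfolding r_def by auto
      have "(j + 1) div l = q" "(j + 1) mod l = r + 1"
        unfolding jq using r by (simp_all add: div_mult_self3 mod_mult_self3)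
      then show ?thesis
        using 3(1) A_edge B_edge unfolding w_def by (simp add: q_def r_def)
    next
      case 4
      define q where "q = j div l"
      have "j + 1 = q * l + (j mod l + 1)" unfolding q_def by simp
      then have jq: "j + 1 = (q + 1) * l" using 4(2) by (simp add: algebra_simps)
      have "(j + 1) mod l = 0" unfolding jq by simp
      then have "w S (j + 1) = \<beta>" using 4(1) start unfolding w_def by simp
      moreover have "j mod l = l - 1" using 4(2) by simp
      ultimately show ?thesis using 4(1) last unfolding w_def by simp
    qed
  qed
  have "inj w"
  proof (rule injI)
    fix S S' assume eq: "w S = w S'"
    define i where "i = j0 - a"
    have i: "0 \<le> i" "i < l" "i < d - b" using j0 b d unfolding i_def l_def by auto
    have AB: "A i \<noteq> B i"
      using j0(2) i unfolding A_def B_def by (simp add: i_def algebra_simps)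
    have "n \<in> T \<longleftrightarrow> w T (int n * l + i) = B i" for n T
    proof -
      have "\<not> int n * l + i < 0" using i l by (simp add: not_less)
      moreover have "(int n * l + i) div l = int n" "(int n * l + i) mod l = i"
        using i by simp_all
      ultimately have "w T (int n * l + i) = (if int n \<in> int ` T then B else A) i"
        unfolding w_def by simp
      then show ?thesis using AB by (auto simp: inj_image_mem_iff)
    qed
    from this[of _ S] this[of _ S'] show "S = S'" unfolding eq by blast
  qed
  moreover have "range w \<subseteq> {s'. \<forall>j::int. \<exists>k. s' j = s k \<and> s' (j + 1) = s (k + 1)}"
    by (intro image_subsetI CollectI allI w_edge[unfolded edge_def])
  ultimately have "\<not> countable {s'. \<forall>j::int. \<exists>k. s' j = s k \<and> s' (j + 1) = s (k + 1)}"
    by (rule uncountable_if_encodes_sets)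
  with count show False by contradiction
qed

text \<open>For a period \<open>w\<close>, the function \<open>cross w\<close> measures the
  progress across the direction of \<open>w\<close> and \<open>dot w\<close> that along
  \<open>w\<close>. Both are taken without dividing by the length of \<open>w\<close>, so that
  they stay integers.\<close>
definition dot :: "int \<times> int \<Rightarrow> int \<times> int \<Rightarrow> int" where
  "dot u v = fst u * fst v + snd u * snd v"

definition rot :: "int \<times> int \<Rightarrow> int \<times> int" where
  "rot w = (- snd w, fst w)"

lemma cross_add: "cross w (u + v) = cross w u + cross w v" "cross w (u - v) = cross w u - cross w v"
  by (simp_all add: cross_def algebra_simps)

lemma dot_diff: "dot w (u - v) = dot w u - dot w v"
  by (simp add: dot_def algebra_simps)

lemma dot_smul: "dot w (smul k v) = k * dot w v"
  by (simp add: dot_def smul_def algebra_simps)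

lemma cross_self [simp]: "cross w w = 0"
  by (simp add: cross_def)

lemma cross_rot: "cross w (rot w) = dot w w"
  by (simp add: cross_def dot_def rot_def)

lemma dot_self_pos: "w \<noteq> 0 \<Longrightarrow> dot w w > 0"
  unfolding dot_def by (metis prod_eq_iff sum_squares_gt_zero_iff fst_zero snd_zero)

lemma cross_uminus: "cross (- w) v = - cross w v"
  by (simp add: cross_def)

lemma finite_strip_segment:
  assumes "w \<noteq> 0"
  shows "finite {v. l \<le> cross w v \<and> cross w v \<le> h \<and> 0 \<le> dot w v \<and> dot w v < dot w w}"
    (is "finite ?F")
proof (rule inj_on_finite)
  show "inj_on (\<lambda>v. (cross w v, dot w v)) ?F"
  proof (rule inj_onI)
    fix u v assume "(cross w u, dot w u) = (cross w v, dot w v)"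
    moreover have "dot w w * fst v = fst w * dot w v - snd w * cross w v"
      "dot w w * snd v = snd w * dot w v + fst w * cross w v" for v
      by (simp_all add: dot_def cross_def algebra_simps)
    ultimately have "dot w w * fst u = dot w w * fst v" "dot w w * snd u = dot w w * snd v"
      by simp_all
    then show "u = v" using dot_self_pos[OF assms] by (simp add: prod_eq_iff)
  qed
  show "(\<lambda>v. (cross w v, dot w v)) ` ?F \<subseteq> {l..h} \<times> {0..dot w w}" by auto
qed simp

text \<open>Together with \<open>finite_strip_segment\<close>: modulo the period \<open>w\<close>,
  a strip of bounded width in direction \<open>w\<close> is finite.\<close>
lemma reduce_along_period:
  assumes "w \<noteq> 0"
  shows "0 \<le> dot w (v - smul (dot w v div dot w w) w)"
    "dot w (v - smul (dot w v div dot w w) w) < dot w w"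
    "cross w (v - smul k w) = cross w v"
  using dot_self_pos[OF assms] by (simp_all add: dot_diff dot_smul cross_add cross_smul minus_div_mult_eq_mod)

text \<open>The plane is cut into strips in the direction of \<open>w\<close>, so wide that a
  window meets at most two consecutive ones. Since \<open>w\<close> is a period, only finitely
  many contents of strips occur, and \<open>c\<close> becomes a walk \<open>s\<close> on them.
  Every walk with the same steps assembles to an element of the countable set \<open>X\<close>, so
  \<open>walk_eventually_periodic\<close> applies. The half-plane in the other sense is covered by
  the period \<open>- w\<close>.\<close>
lemma periodic_config_eventually_doubly_periodic:
  fixes X :: "('a::finite) config set"
  assumes X: "subshift X" "loc W X \<subseteq> X" "countable X"
    and c: "c \<in> X" "has_period c w" "w \<noteq> 0"
  shows "\<exists>m>0. \<exists>K. \<forall>v. cross w v \<ge> K \<longrightarrow> c (v + smul m (rot w)) = c v"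
proof -
  define B where "B = int W * (\<bar>fst w\<bar> + \<bar>snd w\<bar>)"
  \<comment> \<open>The strips have width \<open>L > 2 * B\<close>, where \<open>B\<close> bounds
    the extent of a window across \<open>w\<close>.\<close>
  define M where "M = 2 * B + 1"
  define e where "e = smul M (rot w)"
  define L where "L = cross w e"
  have B0: "B \<ge> 0" unfolding B_def by simp
  have L_eq: "L = M * dot w w" unfolding L_def e_def by (simp add: cross_smul cross_rot)
  have "M * 1 \<le> L"
    unfolding L_eq using dot_self_pos[OF c(3)] B0 by (intro mult_left_mono) (auto simp: M_def)
  then have BL: "2 * B < L" unfolding M_def by simp
  then have L0: "L > 0" using B0 by simp
  have cross_ball: "\<bar>cross w b\<bar> \<le> B" if "b \<in> square W" for b
  proof -
    have "\<bar>fst w * snd b\<bar> \<le> \<bar>fst w\<bar> * int W" "\<bar>snd w * fst b\<bar> \<le> \<bar>snd w\<bar> * int W"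
      using that unfolding square_def abs_mult by (auto intro: mult_left_mono)
    then have "\<bar>fst w * snd b - snd w * fst b\<bar> \<le> \<bar>fst w\<bar> * int W + \<bar>snd w\<bar> * int W"
      by linarith
    then show ?thesis unfolding cross_def B_def by (simp add: algebra_simps)
  qed
  \<comment> \<open>The contents of the strip \<open>j\<close>, moved to the strip 0. The default
    outside makes equal contents equal functions.\<close>
  define s where "s j = (\<lambda>v. if 0 \<le> cross w v \<and> cross w v < L then c (v + smul j e) else undefined)" for j
  define idx where "idx v = cross w v div L" for v
  define dec where "dec r v = r (idx v) (v - smul (idx v) e)" for r :: "int \<Rightarrow> 'a config" and v
  have slab: "0 \<le> cross w (v - smul (idx v) e)" "cross w (v - smul (idx v) e) < L" for v
    using L0 by (simp_all add: cross_add cross_smul L_def[symmetric] idx_def minus_div_mult_eq_mod)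
  have s_val: "s k (v - smul (idx v) e) = c (v + smul (k - idx v) e)" for k v
  proof -
    have "v - smul (idx v) e + smul k e = v + smul (k - idx v) e"
      by (simp add: smul_def prod_eq_iff algebra_simps)
    then show ?thesis unfolding s_def using slab[of v] by (simp only: if_True simp_thms)
  qed
  have fin: "finite (range s)"
  proof -
    define F where "F = {v. 0 \<le> cross w v \<and> cross w v \<le> L \<and> 0 \<le> dot w v \<and> dot w v < dot w w}"
    \<comment> \<open>Recovers the contents of a strip from a fundamental domain of the
      translation by \<open>w\<close>.\<close>
    define ext where "ext g = (\<lambda>v. if 0 \<le> cross w v \<and> cross w v < L
        then g (v - smul (dot w v div dot w w) w) else undefined)" for g :: "'a config"
    have "s j = ext (restrict (\<lambda>x. c (x + smul j e)) F)" for j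
    proof
      fix v
      define k where "k = dot w v div dot w w"
      have "v - smul k w \<in> F" if "0 \<le> cross w v" "cross w v < L"
        using reduce_along_period[OF c(3), of v] that unfolding F_def k_def by auto
      moreover have "c (v - smul k w + smul j e) = c (v + smul j e)"
      proof -
        have "c ((v - smul k w + smul j e) + smul k w) = c (v - smul k w + smul j e)"
          using has_period_smul[OF c(2), of k] unfolding has_period_def by blast
        then show ?thesis by simp
      qed
      ultimately show "s j v = ext (restrict (\<lambda>x. c (x + smul j e)) F) v"
        unfolding s_def ext_def k_def[symmetric] by simp
    qed
    then have "range s \<subseteq> ext ` (F \<rightarrow>\<^sub>E UNIV)" by auto
    moreover have "finite (F \<rightarrow>\<^sub>E (UNIV :: 'a set))"
      unfolding F_def by (intro finite_PiE finite_strip_segment c(3)) simp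
    ultimately show ?thesis by (meson finite_imageI finite_subset)
  qed
  define walks where "walks = {r. \<forall>j::int. \<exists>k. r j = s k \<and> r (j + 1) = s (k + 1)}"
  have "dec r \<in> loc W X" if r: "r \<in> walks" for r
    unfolding loc_def
  proof (intro CollectI allI)
    fix v
    define j where "j = (cross w v - B) div L"
    obtain k where k: "r j = s k" "r (j + 1) = s (k + 1)" using r unfolding walks_def by blast
    have "dec r (b + v) = c (b + v + smul (k - j) e)" if b: "b \<in> square W" for b
    proof -
      have "j * L \<le> cross w v - B" "cross w v - B < j * L + L"
        unfolding j_def using minus_mod_eq_div_mult[of "cross w v - B" L]
          pos_mod_bound[OF L0, of "cross w v - B"] pos_mod_sign[OF L0, of "cross w v - B"]
        by linarith+
      then have lo: "j * L \<le> cross w (b + v)" and hi: "cross w (b + v) < (j + 2) * L"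
        using cross_ball[OF b] BL by (auto simp: cross_add algebra_simps)
      have "j \<le> idx (b + v)" unfolding idx_def using zdiv_mono1[OF lo L0] L0 by simp
      moreover have "idx (b + v) < j + 2"
      proof -
        have "idx (b + v) * L \<le> cross w (b + v)"
          unfolding idx_def using minus_mod_eq_div_mult[of "cross w (b + v)" L]
            pos_mod_sign[OF L0, of "cross w (b + v)"] by linarith
        then have "idx (b + v) * L < (j + 2) * L" using hi by (rule order_le_less_trans)
        then show ?thesis using L0 by simp
      qed
      ultimately consider "idx (b + v) = j" | "idx (b + v) = j + 1" by linarith
      then show ?thesis
      proof cases
        case 1
        then show ?thesis using s_val[of k "b + v"] k(1) unfolding dec_def by simp
      next
        case 2
        then show ?thesis using s_val[of "k + 1" "b + v"] k(2) unfolding dec_def by simp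
      qed
    qed
    then have "agree W (translate v (dec r)) (translate (v + smul (k - j) e) c)"
      unfolding agree_def translate_def by (simp add: add.assoc)
    then show "\<exists>z\<in>X. agree W (translate v (dec r)) z" using subshift_translate[OF X(1) c(1)] by blast
  qed
  then have "dec ` walks \<subseteq> X" using X(2) by blast
  then have "countable (dec ` walks)" using X(3) countable_subset by blast
  moreover have "inj_on dec walks"
  proof (rule inj_onI)
    fix r r' assume r: "r \<in> walks" "r' \<in> walks" and eq: "dec r = dec r'"
    have undef: "r j v = undefined" if rv: "r \<in> walks" "\<not> (0 \<le> cross w v \<and> cross w v < L)" for r j v
    proof -
      obtain k where "r j = s k" using rv(1) unfolding walks_def by blast
      then show ?thesis using rv(2) unfolding s_def by (simp only: if_False)
    qed
    have def: "r j v = dec r (v + smul j e)" if "0 \<le> cross w v" "cross w v < L" for r j v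
    proof -
      have "cross w (v + smul j e) = j * L + cross w v"
        by (simp add: cross_add cross_smul L_def)
      then have "idx (v + smul j e) = j" unfolding idx_def using that by simp
      then show ?thesis unfolding dec_def by simp
    qed
    show "r = r'"
    proof (intro ext)
      fix j v
      show "r j v = r' j v"
        using undef[OF r(1)] undef[OF r(2)] def[of v r j] def[of v r' j] eq by metis
    qed
  qed
  ultimately have "countable walks" by (simp add: countable_image_inj_eq)
  then obtain m K where m: "m > 0" "\<And>j. j \<ge> K \<Longrightarrow> s (j + m) = s j"
    using walk_eventually_periodic[OF fin] unfolding walks_def by blast
  have "c (v + smul (m * M) (rot w)) = c v" if "cross w v \<ge> K * L" for v
  proof -
    have "K \<le> idx v"
      unfolding idx_def using zdiv_mono1[OF that L0] L0 by simp
    then have "s (idx v + m) (v - smul (idx v) e) = s (idx v) (v - smul (idx v) e)"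
      using m(2) by simp
    then have "c (v + smul m e) = c v" by (simp add: s_val)
    then show ?thesis by (simp add: e_def smul_smul)
  qed
  moreover have "m * M > 0" using m(1) B0 unfolding M_def by (intro mult_pos_pos) auto
  ultimately show ?thesis by blast
qed

lemma pat_le_has_period:
  assumes "x \<preceq> c" "has_period c w"
  shows "has_period x w"
  unfolding has_period_def
proof
  fix a
  obtain R where R: "{a, a + w} \<subseteq> square R" using finite_subset_square[of "{a, a + w}"] by auto
  obtain v where v: "agree R (translate v c) x" using assms(1) unfolding pat_le_iff_agree by blast
  have "c (a + v + w) = c (a + v)" using assms(2) unfolding has_period_def by blast
  then have "translate v c (a + w) = translate v c a" by (simp add: translate_def ac_simps)
  then show "x (a + w) = x a" using v R unfolding agree_def by (metis insert_subset)
qed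

text \<open>The squares of \<open>x\<close> occur in \<open>c\<close> at positions \<open>f
  R\<close>. If these positions are unbounded across \<open>w\<close>, then \<open>x\<close>
  inherits the second period that \<open>c\<close> has far out. If they are bounded, they take
  finitely many values modulo \<open>w\<close>, and one of these values serves arbitrarily large
  squares.\<close>
lemma below_periodic_config:
  fixes X :: "('a::finite) config set"
  assumes X: "subshift X" "loc W X \<subseteq> X" "countable X"
    and c: "c \<in> X" "has_period c w" "w \<noteq> 0" and x: "x \<preceq> c"
  shows "x \<in> orbit c \<or> finite (orbit x)"
proof -
  obtain f where f: "\<And>R. agree R (translate (f R) c) x" using x unfolding pat_le_iff_agree by metis
  have period_at_end: "has_period x u"
    if u: "\<And>v. cross w' v \<ge> K \<Longrightarrow> c (v + u) = c v"
      and far: "\<And>K R0. \<exists>R\<ge>R0. cross w' (f R) \<ge> K" for w' u K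
    unfolding has_period_def
  proof
    fix a
    obtain R0 where R0: "{a, a + u} \<subseteq> square R0" using finite_subset_square[of "{a, a + u}"] by auto
    obtain R where R: "R \<ge> R0" "cross w' (f R) \<ge> K - cross w' a" using far by blast
    then have "c (a + f R + u) = c (a + f R)" by (intro u) (simp add: cross_add)
    then have "translate (f R) c (a + u) = translate (f R) c a" by (simp add: translate_def ac_simps)
    moreover have "agree R0 (translate (f R) c) x" using f R(1) agree_mono by blast
    ultimately show "x (a + u) = x a" using R0 unfolding agree_def by (metis insert_subset)
  qed
  have xw: "has_period x w" using x c(2) by (rule pat_le_has_period)
  have one_end: "finite (orbit x)"
    if w': "w' \<noteq> 0" "has_period c w'" and far: "\<And>K R0. \<exists>R\<ge>R0. cross w' (f R) \<ge> K" for w'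
  proof -
    obtain m K where m: "m > 0" "\<And>v. cross w' v \<ge> K \<Longrightarrow> c (v + smul m (rot w')) = c v"
      using periodic_config_eventually_doubly_periodic[OF X c(1) w'(2,1)] by blast
    have "has_period x (smul m (rot w'))" using m(2) far by (rule period_at_end)
    moreover have "cross w' (smul m (rot w')) \<noteq> 0"
      using m(1) dot_self_pos[OF w'(1)] by (simp add: cross_smul cross_rot)
    moreover have "has_period x w'" using x w'(2) by (rule pat_le_has_period)
    ultimately show ?thesis using doubly_periodic_finite_orbit by blast
  qed
  show ?thesis
  proof (cases "(\<forall>K R0. \<exists>R\<ge>R0. cross w (f R) \<ge> K) \<or> (\<forall>K R0. \<exists>R\<ge>R0. cross (- w) (f R) \<ge> K)")
    case True
    then show ?thesis
      using one_end[OF c(3,2)] one_end[of "- w"] has_period_uminus[OF c(2)] c(3) by auto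
  next
    case False
    then obtain K1 R1 K2 R2 where K: "\<And>R. R \<ge> R1 \<Longrightarrow> cross w (f R) < K1"
      "\<And>R. R \<ge> R2 \<Longrightarrow> cross (- w) (f R) < K2"
      by (meson not_le)
    define g where "g R = f R - smul (dot w (f R) div dot w w) w" for R
    have g: "translate (g R) c = translate (f R) c" for R
    proof -
      have "f R = g R + smul (dot w (f R) div dot w w) w" unfolding g_def by simp
      then show ?thesis
        using has_period_smul[OF c(2)] unfolding has_period_iff by (metis translate_translate)
    qed
    define F where "F = {v. - K2 \<le> cross w v \<and> cross w v \<le> K1 \<and> 0 \<le> dot w v \<and> dot w v < dot w w}"
    have "g R \<in> F" if "R \<in> {max R1 R2..}" for R
      using reduce_along_period[OF c(3), of "f R"] K(1)[of R] K(2)[of R] that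
      unfolding g_def F_def by (simp add: cross_uminus)
    then have "finite (g ` {max R1 R2..})"
      using finite_strip_segment[OF c(3)] unfolding F_def by (meson finite_subset image_subsetI)
    then obtain R0 where R0: "infinite {R\<in>{max R1 R2..}. g R = g R0}"
      using pigeonhole_infinite[of "{max R1 R2..}" g] by (auto simp: infinite_Ici)
    have "agree R (translate (g R0) c) x" for R
    proof -
      obtain R' where "R' \<ge> R" "g R' = g R0"
        using R0 unfolding infinite_nat_iff_unbounded_le by blast
      then show ?thesis using f[of R'] g[of R'] agree_mono by metis
    qed
    then have "translate (g R0) c = x" by (rule agree_all_eq)
    then show ?thesis unfolding orbit_def by blast
  qed
qed

section \<open>Configurations of level at most one\<close>

lemma level_le_1_no_chain:
  assumes "level X y \<le> enat 1" "y \<in> X" "x \<in> X" "x' \<in> X" "x \<prec> y" "x' \<prec> x"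
  shows False
proof -
  define c where "c = (\<lambda>n :: nat. if n = 0 then y else if n = 1 then x else x')"
  have "decreasing_chain X 2 c"
    using assms(2-6) unfolding decreasing_chain_def c_def by (auto simp: less_Suc_eq numeral_2_eq_2)
  moreover have "c 0 = y" unfolding c_def by simp
  ultimately have "enat 2 \<le> level X y" unfolding level_def by (intro Sup_upper) blast
  with assms(1) have "enat 2 \<le> enat 1" using order_trans by blast
  then show False by simp
qed

text \<open>Let \<open>a\<close> be isolated among the configurations below \<open>y\<close>; then
  \<open>a\<close> is a translate of \<open>y\<close>. Every configuration outside its orbit is
  strictly below \<open>y\<close>, hence minimal because of the level, hence doubly periodic, and
  there is a common period \<open>N\<close> in both coordinates. If \<open>a\<close> has no
  period, then its translates by vectors tending to infinity accumulate only outside its orbit, so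
  far from the origin \<open>a\<close> itself has the local periods \<open>N\<close>: it has a
  finite defect.\<close>
lemma level_le_1_has_period:
  fixes X :: "('a::finite) config set"
  assumes X: "is_SFT X" "countable X" and y: "y \<in> X" "level X y \<le> enat 1"
  shows "\<exists>u. u \<noteq> 0 \<and> has_period y u"
proof (rule ccontr)
  assume no: "\<not> ?thesis"
  have sub: "subshift X" using X(1) by (rule SFT_subshift)
  obtain W where W: "loc W X \<subseteq> X" using SFT_loc[OF X(1)] by blast
  have below_X: "z \<in> X" if "z \<preceq> x" "x \<in> X" for x z
    using sub that(2,1) by (rule subshift_downward_closed)
  have count: "countable {z. z \<preceq> x}" if "x \<in> X" for x
    by (rule countable_subset[OF _ X(2)]) (use below_X that in blast)
  define Z where "Z = {x. x \<preceq> y}"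
  have subZ: "subshift Z" unfolding Z_def by (rule subshift_below)
  have "y \<in> Z" unfolding Z_def by simp
  then have "Z \<noteq> {}" by blast
  moreover have "countable Z" unfolding Z_def using y(1) by (rule count)
  ultimately obtain a R where iso: "isolated_in Z R a"
    using countable_subshift_isolated[OF subZ] by metis
  have iso_eq: "b = a" if "b \<preceq> y" "agree R b a" for b
    using iso that unfolding isolated_in_def Z_def by blast
  have "a \<preceq> y" using iso unfolding isolated_in_def Z_def by blast
  then obtain v where "agree R (translate v y) a" unfolding pat_le_iff_agree by blast
  then have a: "a = translate v y" using iso_eq[of "translate v y"] by simp
  have nonper: "u = 0" if "has_period a u" for u using no that unfolding a by auto
  have aX: "a \<in> X" unfolding a using sub y(1) by (rule subshift_translate)
  define Q where "Q = Z - orbit a"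
  have subQ: "subshift Q" unfolding Q_def using subZ iso by (rule subshift_remove_isolated_orbit)
  have "Q \<subseteq> X" unfolding Q_def Z_def using below_X y(1) by blast
  then have countQ: "countable Q" using X(2) by (rule countable_subset)
  have perQ: "\<exists>k>0. has_period x (smul k e)" if x: "x \<in> Q" for x e
  proof (rule minimal_has_period)
    have xy: "x \<preceq> y" "x \<in> X" using x \<open>Q \<subseteq> X\<close> unfolding Q_def Z_def by auto
    then show "countable {z. z \<preceq> x}" by (intro count)
    have "\<not> y \<preceq> x"
    proof
      assume "y \<preceq> x"
      then have "a \<preceq> x" unfolding a by simp
      then obtain w where "agree R (translate w x) a" unfolding pat_le_iff_agree by blast
      then have "translate w x = a" using xy(1) iso_eq by simp
      then have "x \<in> orbit a" using self_in_orbit[of a] by (metis orbit_translate)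
      with x show False unfolding Q_def by blast
    qed
    then have "x \<prec> y" using xy unfolding pat_less_iff by blast
    show "x \<preceq> z" if "z \<preceq> x" for z
    proof (rule ccontr)
      assume "\<not> x \<preceq> z"
      then have "z \<prec> x" using that unfolding pat_less_iff by blast
      then show False
        using level_le_1_no_chain[OF y(2,1) xy(2) below_X[OF that xy(2)] \<open>x \<prec> y\<close>] by blast
    qed
  qed
  obtain k1 where k1: "k1 > 0" "\<forall>x\<in>Q. has_period x (smul k1 (1, 0))"
    using countable_subshift_common_period[OF subQ countQ perQ] by blast
  obtain k2 where k2: "k2 > 0" "\<forall>x\<in>Q. has_period x (smul k2 (0, 1))"
    using countable_subshift_common_period[OF subQ countQ perQ] by blast
  define N where "N = k1 * k2"
  have N0: "N > 0" using k1(1) k2(1) unfolding N_def by simp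
  have Nper: "has_period x (N, 0)" "has_period x (0, N)" if "x \<in> Q" for x
  proof -
    have "has_period x (smul k2 (smul k1 (1, 0)))" "has_period x (smul k1 (smul k2 (0, 1)))"
      using k1(2) k2(2) that has_period_smul by blast+
    then show "has_period x (N, 0)" "has_period x (0, N)"
      unfolding N_def by (simp_all add: smul_def mult.commute)
  qed
  have "\<exists>K. \<forall>v. v \<notin> square K \<longrightarrow> a (v + (N, 0)) = a v \<and> a (v + (0, N)) = a v"
  proof (rule ccontr)
    assume "\<not> ?thesis"
    then obtain f where f: "\<And>K. f K \<notin> square K"
      "\<And>K. a (f K + (N, 0)) \<noteq> a (f K) \<or> a (f K + (0, N)) \<noteq> a (f K)"
      by metis
    obtain l where l: "\<And>R m. \<exists>n\<ge>m. agree R (translate (f n) a) l"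
      using cluster_point[of "\<lambda>n. translate (f n) a"] by blast
    have trZ: "translate w a \<in> Z" for w using \<open>a \<preceq> y\<close> unfolding Z_def by simp
    have "l \<in> Z"
      by (rule subshift_limit[OF subZ]) (use l[of 0] trZ in blast)
    moreover have "l \<notin> orbit a"
    proof
      assume "l \<in> orbit a"
      then obtain w where w: "l = translate w a" unfolding orbit_def by blast
      obtain S where S: "w \<in> square S" using ex_square by blast
      obtain n where n: "n \<ge> S" "agree (R + S) (translate (f n) a) l" using l by blast
      then have "translate (f n) a = translate w a"
        using isolated_translateD[OF iso subZ trZ S] w by blast
      then have "has_period a (f n - w)"
        unfolding has_period_iff by (simp add: translate_eq_iff)
      then have "f n = w" using nonper by fastforce
      then show False using f(1)[of n] S square_mono[OF n(1)] by blast
    qed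
    ultimately have lQ: "l \<in> Q" unfolding Q_def by blast
    obtain S where S: "{(N, 0), (0, N)} \<subseteq> square S" using finite_subset_square[of "{(N, 0), (0, N)}"] by auto
    obtain n where n: "agree S (translate (f n) a) l" using l by blast
    have "l (0 + (N, 0)) = l 0" "l (0 + (0, N)) = l 0"
      using Nper[OF lQ] unfolding has_period_def by blast+
    then have "translate (f n) a (N, 0) = translate (f n) a 0"
      "translate (f n) a (0, N) = translate (f n) a 0"
      using n S unfolding agree_def by simp_all
    then show False using f(2)[of n] by (simp add: translate_def add.commute)
  qed
  then obtain K where K: "\<And>v. v \<notin> square K \<Longrightarrow> a (v + (N, 0)) = a v"
    "\<And>v. v \<notin> square K \<Longrightarrow> a (v + (0, N)) = a v" by blast
  have "\<not> has_period a (N, 0)" using nonper[of "(N, 0)"] N0 by (auto simp: prod_eq_iff)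
  then have "\<not> countable X"
    using finite_defect_uncountable[OF sub W aX N0 K] by blast
  with X(2) show False by blast
qed

section \<open>Infinite decreasing chains\<close>

theorem theorem4p7:
  fixes X :: "('a::finite) config set"
  assumes "is_SFT X" and "countable X"
  shows "\<not> (\<exists>c. infinite_decreasing_chain_down_to X 1 c)"
proof
  assume "\<exists>c. infinite_decreasing_chain_down_to X 1 c"
  then obtain c where cX: "\<And>n. c n \<in> X" and less: "\<And>n. c (Suc n) \<prec> c n"
    and level: "\<And>x. (\<And>n. x \<preceq> c n) \<Longrightarrow> level X x \<le> enat 1"
    unfolding infinite_decreasing_chain_down_to_def by blast
  have sub: "subshift X" using assms(1) by (rule SFT_subshift)
  obtain W where W: "loc W X \<subseteq> X" using SFT_loc[OF assms(1)] by blast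
  define Z where "Z n = {x. x \<preceq> c n}" for n
  have subZ: "subshift (Z n)" for n unfolding Z_def by (rule subshift_below)
  have decZ: "Z (Suc n) \<subseteq> Z n" for n
    using less[of n] pat_le_trans unfolding Z_def pat_less_iff by blast
  define Y where "Y = (\<Inter>n. Z n)"
  have subY: "subshift Y" unfolding Y_def using subZ by (rule subshift_Inter)
  have YX: "y \<in> X" if "y \<in> Y" for y
    using subshift_downward_closed[OF sub cX[of 0]] that unfolding Y_def Z_def by blast
  have "finitely_many_periods Y"
  proof (rule countable_subshift_finitely_many_periods[OF subY])
    show "countable Y" by (rule countable_subset[OF _ assms(2)]) (use YX in blast)
    fix y assume y: "y \<in> Y"
    then have "level X y \<le> enat 1" by (intro level) (simp add: Y_def Z_def)
    then show "\<exists>u. u \<noteq> 0 \<and> has_period y u"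
      using level_le_1_has_period[OF assms YX[OF y]] by blast
  qed
  then obtain T where T: "\<And>A. A \<subseteq> loc T Y \<Longrightarrow> finitely_many_periods A"
    using finitely_many_periods_loc by blast
  obtain n where "Z n \<subseteq> loc T Y"
    using decreasing_subshifts_loc[of Z T] subZ decZ unfolding Y_def by blast
  then have "finitely_many_periods (Z n)" by (rule T)
  moreover have "c n \<in> Z n" unfolding Z_def by simp
  ultimately obtain w where w: "w \<noteq> 0" "has_period (c n) w"
    unfolding finitely_many_periods_def by metis
  have below: "c (Suc n) \<preceq> c n" "\<not> c n \<preceq> c (Suc n)"
    using less[of n] unfolding pat_less_iff by blast+
  then have "finite (orbit (c (Suc n)))"
    using below_periodic_config[OF sub W assms(2) cX w(2,1) below(1)] orbit_pat_le by blast
  then have "c (Suc n) \<preceq> c (Suc (Suc n))"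
    using less[of "Suc n"] finite_orbit_minimal unfolding pat_less_iff by blast
  then show False using less[of "Suc n"] unfolding pat_less_iff by blast
qed

end
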